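(* Let $q\colon E\to M$ be a submersion in a tangent category $(\mathbb X,\mathbb T)$ and let $\psi\colon TE\to TE$ be a morphism. The following are equivalent: (1) $\psi$ is a split abstract horizontal connection on $q$; (2) there is a full horizontal connection $H$ on $q$ whose horizontal connection form is $\psi$, i.e. $\pi_qH=\psi$; (3) there is a horizontal connection $H$ on $q$ which is the horizontal component of an Ehresmann connection $(R,H)$ on $q$ and whose horizontal connection form is $\psi$, i.e. $\pi_qH=\psi$.
   Context: Composition is diagrammatic: $fg$ is $f$ followed by $g$; $\langle f,g\rangle$ denotes pairing into a (fibred) product, with projections $\pi_1,\pi_2$. A tangent category $(\mathbb X,\mathbb T)$ is a category $\mathbb X$ with an endofunctor $T$ and natural transformations $p_M\colon TM\to M$, $z_M\colon M\to TM$, $s_M\colon T_2M\to TM$, $l_M\colon TM\to T^2M$, $c_M\colon T^2M\to T^2M$, where the $n$-fold pullback $T_nM$ of $p_M$ along itself exists and is preserved by all $T^m$, such that: $(p_M,z_M,s_M)$ is an additive bundle (a commutative monoid in the category over $M$); $(z_M,l_M)\colon p_M\to Tp_M$ and $(\mathrm{id}_{TM},c_M)\colon Tp_M\to p_{TM}$ are additive bundle morphisms (commutative squares preserving zero and sum); $c_Mc_M=\mathrm{id}$, $l_Mc_M=l_M$, $l_M\,Tl_M=l_M\,l_{TM}$, $Tc_M\,c_{TM}\,Tc_M=c_{TM}\,Tc_M\,c_{TM}$, $l_{TM}\,Tc_M\,c_{TM}=c_M\,Tl_M$; and, with $\xi_M=\langle\pi_1l_M,\pi_2z_{TM}\rangle\,Ts_M\colon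 T_2M\to T^2M$, the square $\xi_M\,Tp_M=\pi_1p_Mz_M$ is a tangent pullback. A tangent pullback is a pullback preserved by $T^m$ for all $m\ge0$. A tangent display map is a morphism $q\colon E\to M$ such that for all $n\ge0$ and all $f\colon N\to T^nM$ the pullback of $T^nq$ along $f$ exists and is a tangent pullback. A differential bundle $\mathbf q\colon E\to M$ consists of $q\colon E\to M$, $z_q\colon M\to E$, $s_q\colon E_2\to E$, $l_q\colon E\to TE$ ($E_n$ the $n$-fold pullback of $q$ along itself, required to exist and be preserved by all $T^m$) such that $(q,z_q,s_q)$ is an additive bundle, $(z_M,l_q)\colon q\to Tq$ and $(z_q,l_q)\colon q\to p_E$ are additive bundle morphisms, $l_ql_E=l_q\,Tl_q$, and with $\xi_q=\langle\pi_1l_q,\pi_2z_E\rangle\,Ts_q\colon E_2\to TE$ the square $\xi_q\,Tq=\pi_1qz_M$ is a tangent pullback. Convention: all differential bundles are assumed display, i.e. $q$ is a tangent display map. A morphism $(f,g)\colon\mathbf q\to\mathbf q'$ (with $qf=gq'$) is linear if $g\,l_{q'}=l_q\,Tg$. $\mathsf{DB}(E)$ is the category of differential bundles over $E$ and linear morphisms over $\mathrm{id}_E$; it has finite biproducts, with zero object the trivial bundle $\mathbf 0_E=(\mathrm{id}_E,\mathrm{id}_E,\mathrm{id}_E,z_E)$. $\mathbf p_E=(p_E,z_E,s_E,l_E)$ is the tangent bundle. For a tangent display map $q\colon E\to M$: the vertical bundle $\mathbf q^V\colon Vq\to E$ is given by the tangent pullback $Vq$ of $Tq$ along $z_M$,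 with projections $\iota_q\colon Vq\to TE$ and $T^Vq\colon Vq\to M$; $q^V=\iota_qp_E$, and its zero $z_q^V$, sum $s^V_q$, lift $l_q^V$ are determined by $z_q^V\iota_q=z_E$, $s_q^V\iota_q=(\iota_q\times\iota_q)s_E$, $l_q^V\,T\iota_q=\iota_ql_E$. The Finsler bundle $\mathbf q^F\colon Fq\to E$ is given by the tangent pullback $Fq$ of $q$ along $p_M$, with projections $q^F\colon Fq\to E$ and $T^Fq\colon Fq\to TM$, its zero $z_q^F$, sum $s_q^F$, lift $l_q^F$ determined by $z_q^Fq^F=\mathrm{id}_E$, $z_q^F\,T^Fq=qz_M$; $s_q^Fq^F=\pi_1q^F$, $s_q^F\,T^Fq=(T^Fq\times T^Fq)s_M$; $l_q^F\,Tq^F=q^Fz_E$, $l_q^F\,T(T^Fq)=T^Fq\,l_M$. The horizontal descent $\pi_q\colon TE\to Fq$ is the unique morphism with $\pi_qq^F=p_E$ and $\pi_q\,T^Fq=Tq$. The square $\iota_q\pi_q=q^Vz_q^F$ (with corners $\mathbf q^V,\mathbf p_E,\mathbf 0_E,\mathbf q^F$) is commutative in $\mathsf{DB}(E)$; $q$ is a submersion if it is a pushout in $\mathsf{DB}(E)$. A vertical connection on $q$ is $R\colon TE\to Vq$ with $\iota_qR=\mathrm{id}_{Vq}$ and $R\colon\mathbf p_E\to\mathbf q^V$ linear over $E$ ($Rq^V=p_E$, $Rl_q^V=l_E\,TR$). A horizontal connection on $q$ is $H\colon Fq\to TE$ with $H\pi_q=\mathrm{id}_{Fq}$ and $H\colon\mathbf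 q^F\to\mathbf p_E$ linear over $E$ ($Hp_E=q^F$, $Hl_E=l_q^F\,TH$); its horizontal connection form is $\pi_qH\colon TE\to TE$. It is full if the square $z_q^V\iota_q=z_q^FH$ (with corners $\mathbf 0_E,\mathbf q^V,\mathbf q^F,\mathbf p_E$) is a pushout in $\mathsf{DB}(E)$. An Ehresmann connection on $q$ is a pair $(R,H)$ of a vertical connection and a horizontal connection (its horizontal component) with $HR=q^Fz_q^V$ and $\langle R\iota_q,\pi_qH\rangle s_E=\mathrm{id}_{TE}$. An abstract horizontal connection on a tangent display map $q$ is a morphism $\psi\colon TE\to TE$ such that: $\psi\psi=\psi$; $\psi\colon\mathbf p_E\to\mathbf p_E$ is linear over $E$ ($\psi p_E=p_E$, $\psi l_E=l_E\,T\psi$); and the square $\iota_q\psi=q^Vz_q^V\iota_q$ (with top $q^Vz_q^V\colon\mathbf q^V\to\mathbf 0_E\to\mathbf q^V$, both vertical sides $\iota_q\colon\mathbf q^V\to\mathbf p_E$, bottom $\psi\colon\mathbf p_E\to\mathbf p_E$) commutes and is a pushout in $\mathsf{DB}(E)$. It is split if the idempotent $\psi$ on $\mathbf p_E$ splits in $\mathsf{DB}(E)$, i.e. there are a differential bundle $\mathbf r$ over $E$ and linear morphisms over $E$, $\sigma\colon\mathbf r\to\mathbf p_E$ and $\rho\colon\mathbf p_E\to\mathbf r$, with $\sigma\rho=\mathrm{id}$ and $\rho\sigma=\psi$. *)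

theory Defs
  imports Main
begin

text \<open>Composition is diagrammatic: \<open>f \<cdot> g\<close> is \<open>f\<close> followed by \<open>g\<close>.\<close>

record ('o, 'a) precat =
  Ob :: "'o set"
  Ar :: "'a set"
  Src :: "'a \<Rightarrow> 'o"
  Tgt :: "'a \<Rightarrow> 'o"
  Idn :: "'o \<Rightarrow> 'a"
  Cmp :: "['a, 'a] \<Rightarrow> 'a"  (infixl "\<cdot>\<index>" 70)

definition hom :: "('o, 'a, 'm) precat_scheme \<Rightarrow> 'o \<Rightarrow> 'o \<Rightarrow> 'a set" where
  "hom X A B = {f \<in> Ar X. Src X f = A \<and> Tgt X f = B}"

locale category =
  fixes X :: "('o, 'a, 'm) precat_scheme" (structure)
  assumes Src_Ob: "f \<in> Ar X \<Longrightarrow> Src X f \<in> Ob X"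
    and Tgt_Ob: "f \<in> Ar X \<Longrightarrow> Tgt X f \<in> Ob X"
    and Idn_hom: "A \<in> Ob X \<Longrightarrow> Idn X A \<in> hom X A A"
    and Cmp_hom: "\<lbrakk>f \<in> hom X A B; g \<in> hom X B C\<rbrakk> \<Longrightarrow> f \<cdot> g \<in> hom X A C"
    and Idn_left: "f \<in> hom X A B \<Longrightarrow> Idn X A \<cdot> f = f"
    and Idn_right: "f \<in> hom X A B \<Longrightarrow> f \<cdot> Idn X B = f"
    and Cmp_assoc: "\<lbrakk>f \<in> hom X A B; g \<in> hom X B C; h \<in> hom X C D\<rbrakk>
                    \<Longrightarrow> (f \<cdot> g) \<cdot> h = f \<cdot> (g \<cdot> h)"

context
  fixes X :: "('o, 'a, 'm) precat_scheme" (structure)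
begin

text \<open>\<open>is_pullback p1 p2 f g\<close>: the square \<open>p1 \<cdot> f = p2 \<cdot> g\<close> is a pullback of \<open>f\<close> and \<open>g\<close>.\<close>

definition is_pullback :: "'a \<Rightarrow> 'a \<Rightarrow> 'a \<Rightarrow> 'a \<Rightarrow> bool" where
  "is_pullback p1 p2 f g \<longleftrightarrow>
     f \<in> Ar X \<and> g \<in> Ar X \<and> Tgt X f = Tgt X g \<and>
     p1 \<in> hom X (Src X p1) (Src X f) \<and> p2 \<in> hom X (Src X p1) (Src X g) \<and>
     p1 \<cdot> f = p2 \<cdot> g \<and>
     (\<forall>Y. \<forall>a \<in> hom X Y (Src X f). \<forall>b \<in> hom X Y (Src X g). a \<cdot> f = b \<cdot> g \<longrightarrow>
        (\<exists>!u. u \<in> hom X Y (Src X p1) \<and> u \<cdot> p1 = a \<and> u \<cdot> p2 = b))"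

text \<open>\<open>is_pushout f g u v\<close>: the square \<open>f \<cdot> u = g \<cdot> v\<close> is a pushout of \<open>f\<close> and \<open>g\<close>.\<close>

definition is_pushout :: "'a \<Rightarrow> 'a \<Rightarrow> 'a \<Rightarrow> 'a \<Rightarrow> bool" where
  "is_pushout f g u v \<longleftrightarrow>
     f \<in> Ar X \<and> g \<in> Ar X \<and> Src X f = Src X g \<and>
     u \<in> hom X (Tgt X f) (Tgt X u) \<and> v \<in> hom X (Tgt X g) (Tgt X u) \<and>
     f \<cdot> u = g \<cdot> v \<and>
     (\<forall>Y. \<forall>a \<in> hom X (Tgt X f) Y. \<forall>b \<in> hom X (Tgt X g) Y. f \<cdot> a = g \<cdot> b \<longrightarrow>
        (\<exists>!h. h \<in> hom X (Tgt X u) Y \<and> u \<cdot> h = a \<and> v \<cdot> h = b))"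

text \<open>The pairing \<open>\<langle>a, b\<rangle>\<close> into a pullback with projections \<open>p1\<close>, \<open>p2\<close>.\<close>

definition pairing :: "'a \<Rightarrow> 'a \<Rightarrow> 'a \<Rightarrow> 'a \<Rightarrow> 'a" where
  "pairing p1 p2 a b =
     (THE u. u \<in> hom X (Src X a) (Src X p1) \<and> u \<cdot> p1 = a \<and> u \<cdot> p2 = b)"

text \<open>\<open>P\<close>, with structure map \<open>w\<close> to the base and projections \<open>\<pi> i\<close> for \<open>i < n\<close>, is the
  \<open>n\<close>-fold pullback of \<open>q\<close> along itself.  The map \<open>w\<close> is redundant unless \<open>n = 0\<close>, where the
  \<open>0\<close>-fold pullback is the base itself.\<close>

definition is_fibre_power :: "'a \<Rightarrow> nat \<Rightarrow> 'o \<Rightarrow> 'a \<Rightarrow> (nat \<Rightarrow> 'a) \<Rightarrow> bool" where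
  "is_fibre_power q n P w \<pi> \<longleftrightarrow>
     q \<in> Ar X \<and> w \<in> hom X P (Tgt X q) \<and>
     (\<forall>i<n. \<pi> i \<in> hom X P (Src X q) \<and> \<pi> i \<cdot> q = w) \<and>
     (\<forall>Y. \<forall>v \<in> hom X Y (Tgt X q). \<forall>a. (\<forall>i<n. a i \<in> hom X Y (Src X q) \<and> a i \<cdot> q = v) \<longrightarrow>
        (\<exists>!u. u \<in> hom X Y P \<and> u \<cdot> w = v \<and> (\<forall>i<n. u \<cdot> \<pi> i = a i)))"

end

text \<open>A bundle carries a chosen pullback of its projection along itself, given by its two
  projections \<open>pr1\<close>, \<open>pr2\<close>; its total space \<open>E\<close> and its base \<open>M\<close> are the source and target
  of \<open>proj\<close>.\<close>

record 'a add_bundle =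
  proj :: 'a
  zero :: 'a
  add :: 'a
  pr1 :: 'a
  pr2 :: 'a

record 'a diff_bundle = "'a add_bundle" +
  lift :: 'a

context
  fixes X :: "('o, 'a, 'm) precat_scheme" (structure)
begin

definition additive_bundle :: "('a, 'r) add_bundle_scheme \<Rightarrow> bool" where
  "additive_bundle b \<longleftrightarrow>
     (let q = proj b; z = zero b; s = add b; E = Src X q; M = Tgt X q;
          pair = pairing X (pr1 b) (pr2 b)
      in is_pullback X (pr1 b) (pr2 b) q q \<and>
         z \<in> hom X M E \<and> z \<cdot> q = Idn X M \<and>
         s \<in> hom X (Src X (pr1 b)) E \<and> s \<cdot> q = pr1 b \<cdot> q \<and>
         pair (Idn X E) (q \<cdot> z) \<cdot> s = Idn X E \<and>
         pair (pr2 b) (pr1 b) \<cdot> s = s \<and>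
         (\<exists>P w \<pi>. is_fibre_power X q 3 P w \<pi> \<and>
            pair (pair (\<pi> 0) (\<pi> 1) \<cdot> s) (\<pi> 2) \<cdot> s = pair (\<pi> 0) (pair (\<pi> 1) (\<pi> 2) \<cdot> s) \<cdot> s))"

text \<open>\<open>f\<close> is the map on bases and \<open>g\<close> the map on total spaces.\<close>

definition additive_morphism ::
    "('a, 'r) add_bundle_scheme \<Rightarrow> ('a, 's) add_bundle_scheme \<Rightarrow> 'a \<Rightarrow> 'a \<Rightarrow> bool" where
  "additive_morphism b b' f g \<longleftrightarrow>
     f \<in> hom X (Tgt X (proj b)) (Tgt X (proj b')) \<and>
     g \<in> hom X (Src X (proj b)) (Src X (proj b')) \<and>
     g \<cdot> proj b' = proj b \<cdot> f \<and>
     zero b \<cdot> g = f \<cdot> zero b' \<and>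
     add b \<cdot> g = pairing X (pr1 b') (pr2 b') (pr1 b \<cdot> g) (pr2 b \<cdot> g) \<cdot> add b'"

end

text \<open>\<open>tpr1 M\<close>, \<open>tpr2 M\<close> are the projections of the chosen \<open>T\<^sub>2 M\<close>, the source of \<open>ts M\<close>.\<close>

record ('o, 'a) tangent_precat = "('o, 'a) precat" +
  Tob :: "'o \<Rightarrow> 'o"
  Tar :: "'a \<Rightarrow> 'a"
  tp :: "'o \<Rightarrow> 'a"
  tz :: "'o \<Rightarrow> 'a"
  ts :: "'o \<Rightarrow> 'a"
  tl :: "'o \<Rightarrow> 'a"
  tc :: "'o \<Rightarrow> 'a"
  tpr1 :: "'o \<Rightarrow> 'a"
  tpr2 :: "'o \<Rightarrow> 'a"

context
  fixes X :: "('o, 'a, 'm) tangent_precat_scheme" (structure)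
begin

definition tangent_pullback :: "'a \<Rightarrow> 'a \<Rightarrow> 'a \<Rightarrow> 'a \<Rightarrow> bool" where
  "tangent_pullback p1 p2 f g \<longleftrightarrow>
     (\<forall>m. is_pullback X ((Tar X ^^ m) p1) ((Tar X ^^ m) p2) ((Tar X ^^ m) f) ((Tar X ^^ m) g))"

definition has_tangent_fibre_powers :: "'a \<Rightarrow> bool" where
  "has_tangent_fibre_powers q \<longleftrightarrow>
     (\<forall>n. \<exists>P w \<pi>. \<forall>m. is_fibre_power X ((Tar X ^^ m) q) n
                         ((Tob X ^^ m) P) ((Tar X ^^ m) w) (\<lambda>i. (Tar X ^^ m) (\<pi> i)))"

definition tangent_display_map :: "'a \<Rightarrow> bool" where
  "tangent_display_map q \<longleftrightarrow> q \<in> Ar X \<and>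
     (\<forall>n. \<forall>f \<in> Ar X. Tgt X f = (Tob X ^^ n) (Tgt X q) \<longrightarrow>
        (\<exists>p1 p2. tangent_pullback p1 p2 ((Tar X ^^ n) q) f))"

definition tangent_bundle :: "'o \<Rightarrow> 'a diff_bundle" where
  "tangent_bundle M =
     \<lparr>proj = tp X M, zero = tz X M, add = ts X M, pr1 = tpr1 X M, pr2 = tpr2 X M, lift = tl X M\<rparr>"

definition T_bundle :: "('a, 'r) add_bundle_scheme \<Rightarrow> 'a add_bundle" where
  "T_bundle b =
     \<lparr>proj = Tar X (proj b), zero = Tar X (zero b), add = Tar X (add b),
      pr1 = Tar X (pr1 b), pr2 = Tar X (pr2 b)\<rparr>"

text \<open>\<open>\<xi> = \<langle>\<pi>\<^sub>1 l, \<pi>\<^sub>2 z\<^sub>E\<rangle> T s : E\<^sub>2 \<rightarrow> T E\<close>, the pairing being into \<open>T E\<^sub>2\<close>.\<close>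

definition xi :: "('a, 'r) diff_bundle_scheme \<Rightarrow> 'a" where
  "xi b =
     pairing X (Tar X (pr1 b)) (Tar X (pr2 b)) (pr1 b \<cdot> lift b) (pr2 b \<cdot> tz X (Src X (proj b)))
     \<cdot> Tar X (add b)"

definition xi_universal :: "('a, 'r) diff_bundle_scheme \<Rightarrow> bool" where
  "xi_universal b \<longleftrightarrow>
     tangent_pullback (xi b) (pr1 b \<cdot> proj b) (Tar X (proj b)) (tz X (Tgt X (proj b)))"

end

locale tangent_category = category X
  for X :: "('o, 'a, 'm) tangent_precat_scheme" (structure) +
  assumes Tob_Ob: "M \<in> Ob X \<Longrightarrow> Tob X M \<in> Ob X"
    and Tar_hom: "f \<in> hom X M N \<Longrightarrow> Tar X f \<in> hom X (Tob X M) (Tob X N)"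
    and Tar_Idn: "M \<in> Ob X \<Longrightarrow> Tar X (Idn X M) = Idn X (Tob X M)"
    and Tar_Cmp: "\<lbrakk>f \<in> hom X L M; g \<in> hom X M N\<rbrakk> \<Longrightarrow> Tar X (f \<cdot> g) = Tar X f \<cdot> Tar X g"
    and tp_hom: "M \<in> Ob X \<Longrightarrow> tp X M \<in> hom X (Tob X M) M"
    and tz_hom: "M \<in> Ob X \<Longrightarrow> tz X M \<in> hom X M (Tob X M)"
    and ts_hom: "M \<in> Ob X \<Longrightarrow> ts X M \<in> hom X (Src X (tpr1 X M)) (Tob X M)"
    and tl_hom: "M \<in> Ob X \<Longrightarrow> tl X M \<in> hom X (Tob X M) (Tob X (Tob X M))"
    and tc_hom: "M \<in> Ob X \<Longrightarrow> tc X M \<in> hom X (Tob X (Tob X M)) (Tob X (Tob X M))"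
    and tp_nat: "f \<in> hom X M N \<Longrightarrow> tp X M \<cdot> f = Tar X f \<cdot> tp X N"
    and tz_nat: "f \<in> hom X M N \<Longrightarrow> tz X M \<cdot> Tar X f = f \<cdot> tz X N"
    and ts_nat: "f \<in> hom X M N \<Longrightarrow>
       ts X M \<cdot> Tar X f =
         pairing X (tpr1 X N) (tpr2 X N) (tpr1 X M \<cdot> Tar X f) (tpr2 X M \<cdot> Tar X f) \<cdot> ts X N"
    and tl_nat: "f \<in> hom X M N \<Longrightarrow> tl X M \<cdot> Tar X (Tar X f) = Tar X f \<cdot> tl X N"
    and tc_nat: "f \<in> hom X M N \<Longrightarrow> tc X M \<cdot> Tar X (Tar X f) = Tar X (Tar X f) \<cdot> tc X N"
    and T2_pullback: "M \<in> Ob X \<Longrightarrow> tangent_pullback X (tpr1 X M) (tpr2 X M) (tp X M) (tp X M)"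
    and Tn_pullback: "M \<in> Ob X \<Longrightarrow> has_tangent_fibre_powers X (tp X M)"
    and tangent_additive: "M \<in> Ob X \<Longrightarrow> additive_bundle X (tangent_bundle X M)"
    and tl_additive: "M \<in> Ob X \<Longrightarrow>
       additive_morphism X (tangent_bundle X M) (T_bundle X (tangent_bundle X M)) (tz X M) (tl X M)"
    and tc_additive: "M \<in> Ob X \<Longrightarrow>
       additive_morphism X (T_bundle X (tangent_bundle X M)) (tangent_bundle X (Tob X M))
         (Idn X (Tob X M)) (tc X M)"
    and tc_tc: "M \<in> Ob X \<Longrightarrow> tc X M \<cdot> tc X M = Idn X (Tob X (Tob X M))"
    and tl_tc: "M \<in> Ob X \<Longrightarrow> tl X M \<cdot> tc X M = tl X M"
    and tl_tl: "M \<in> Ob X \<Longrightarrow> tl X M \<cdot> Tar X (tl X M) = tl X M \<cdot> tl X (Tob X M)"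
    and tc_braid: "M \<in> Ob X \<Longrightarrow>
       Tar X (tc X M) \<cdot> tc X (Tob X M) \<cdot> Tar X (tc X M) =
         tc X (Tob X M) \<cdot> Tar X (tc X M) \<cdot> tc X (Tob X M)"
    and tl_tc_tc: "M \<in> Ob X \<Longrightarrow>
       tl X (Tob X M) \<cdot> Tar X (tc X M) \<cdot> tc X (Tob X M) = tc X M \<cdot> Tar X (tl X M)"
    and tl_universal: "M \<in> Ob X \<Longrightarrow> xi_universal X (tangent_bundle X M)"

context
  fixes X :: "('o, 'a, 'm) tangent_precat_scheme" (structure)
begin

definition differential_bundle :: "'a diff_bundle \<Rightarrow> bool" where
  "differential_bundle b \<longleftrightarrow>
     (let q = proj b; E = Src X q; M = Tgt X q
      in tangent_display_map X q \<and>
         tangent_pullback X (pr1 b) (pr2 b) q q \<and> has_tangent_fibre_powers X q \<and>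
         additive_bundle X b \<and>
         additive_morphism X b (T_bundle X b) (tz X M) (lift b) \<and>
         additive_morphism X b (tangent_bundle X E) (zero b) (lift b) \<and>
         lift b \<cdot> tl X E = lift b \<cdot> Tar X (lift b) \<and>
         xi_universal X b)"

definition linear_morphism :: "'a diff_bundle \<Rightarrow> 'a diff_bundle \<Rightarrow> 'a \<Rightarrow> 'a \<Rightarrow> bool" where
  "linear_morphism b b' f g \<longleftrightarrow>
     f \<in> hom X (Tgt X (proj b)) (Tgt X (proj b')) \<and>
     g \<in> hom X (Src X (proj b)) (Src X (proj b')) \<and>
     g \<cdot> proj b' = proj b \<cdot> f \<and>
     g \<cdot> lift b' = lift b \<cdot> Tar X g"

text \<open>The category of differential bundles over \<open>E\<close>; a morphism is recorded together with its
  source and target bundles.\<close>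

definition DB :: "'o \<Rightarrow> ('a diff_bundle, 'a diff_bundle \<times> 'a \<times> 'a diff_bundle) precat" where
  "DB E =
     (let obs = {b. differential_bundle b \<and> Tgt X (proj b) = E}
      in \<lparr>Ob = obs,
          Ar = {(b, g, b'). b \<in> obs \<and> b' \<in> obs \<and> linear_morphism b b' (Idn X E) g},
          Src = (\<lambda>(b, g, b'). b),
          Tgt = (\<lambda>(b, g, b'). b'),
          Idn = (\<lambda>b. (b, Idn X (Src X (proj b)), b)),
          Cmp = (\<lambda>(b, g, _) (_, h, b'). (b, g \<cdot> h, b'))\<rparr>)"

definition trivial_bundle :: "'o \<Rightarrow> 'a diff_bundle" where
  "trivial_bundle E =
     \<lparr>proj = Idn X E, zero = Idn X E, add = Idn X E, pr1 = Idn X E, pr2 = Idn X E, lift = tz X E\<rparr>"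

text \<open>A choice of tangent pullback of \<open>f\<close> and \<open>g\<close>, as its pair of projections.  It is arbitrary
  when no tangent pullback exists.\<close>

definition tpb :: "'a \<Rightarrow> 'a \<Rightarrow> 'a \<times> 'a" where
  "tpb f g = (SOME (p1, p2). tangent_pullback X p1 p2 f g)"

definition iota :: "'a \<Rightarrow> 'a" where
  "iota q = fst (tpb (Tar X q) (tz X (Tgt X q)))"

definition projV :: "'a \<Rightarrow> 'a" where
  "projV q = iota q \<cdot> tp X (Src X q)"

definition Vob :: "'a \<Rightarrow> 'o" where
  "Vob q = Src X (iota q)"

definition vertical_bundle :: "'a \<Rightarrow> 'a diff_bundle" where
  "vertical_bundle q =
     (let E = Src X q; p12 = tpb (projV q) (projV q); p1 = fst p12; p2 = snd p12
      in \<lparr>proj = projV q,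
          zero = (THE z. z \<in> hom X E (Vob q) \<and> z \<cdot> iota q = tz X E),
          add = (THE s. s \<in> hom X (Src X p1) (Vob q) \<and>
                   s \<cdot> iota q =
                     pairing X (tpr1 X E) (tpr2 X E) (p1 \<cdot> iota q) (p2 \<cdot> iota q) \<cdot> ts X E),
          pr1 = p1,
          pr2 = p2,
          lift = (THE l. l \<in> hom X (Vob q) (Tob X (Vob q)) \<and>
                    l \<cdot> Tar X (iota q) = iota q \<cdot> tl X E)\<rparr>)"

definition projF :: "'a \<Rightarrow> 'a" where
  "projF q = fst (tpb q (tp X (Tgt X q)))"

definition TF :: "'a \<Rightarrow> 'a" where
  "TF q = snd (tpb q (tp X (Tgt X q)))"

definition Fob :: "'a \<Rightarrow> 'o" where
  "Fob q = Src X (projF q)"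

definition finsler_bundle :: "'a \<Rightarrow> 'a diff_bundle" where
  "finsler_bundle q =
     (let E = Src X q; M = Tgt X q; p12 = tpb (projF q) (projF q); p1 = fst p12; p2 = snd p12
      in \<lparr>proj = projF q,
          zero = (THE z. z \<in> hom X E (Fob q) \<and>
                    z \<cdot> projF q = Idn X E \<and> z \<cdot> TF q = q \<cdot> tz X M),
          add = (THE s. s \<in> hom X (Src X p1) (Fob q) \<and>
                   s \<cdot> projF q = p1 \<cdot> projF q \<and>
                   s \<cdot> TF q = pairing X (tpr1 X M) (tpr2 X M) (p1 \<cdot> TF q) (p2 \<cdot> TF q) \<cdot> ts X M),
          pr1 = p1,
          pr2 = p2,
          lift = (THE l. l \<in> hom X (Fob q) (Tob X (Fob q)) \<and>
                    l \<cdot> Tar X (projF q) = projF q \<cdot> tz X E \<and>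
                    l \<cdot> Tar X (TF q) = TF q \<cdot> tl X M)\<rparr>)"

definition descent :: "'a \<Rightarrow> 'a" where
  "descent q =
     (THE h. h \<in> hom X (Tob X (Src X q)) (Fob q) \<and>
             h \<cdot> projF q = tp X (Src X q) \<and> h \<cdot> TF q = Tar X q)"

text \<open>Being a pushout in \<open>DB E\<close> includes that the four corners are objects of \<open>DB E\<close>; in
  particular all of them, among them the tangent bundle of \<open>E\<close>, are display.\<close>

definition submersion :: "'a \<Rightarrow> bool" where
  "submersion q \<longleftrightarrow> tangent_display_map X q \<and>
     (let E = Src X q; V = vertical_bundle q; F = finsler_bundle q;
          P = tangent_bundle X E; Z = trivial_bundle E
      in is_pushout (DB E) (V, iota q, P) (V, projV q, Z) (P, descent q, F) (Z, zero F, F))"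

definition vertical_connection :: "'a \<Rightarrow> 'a \<Rightarrow> bool" where
  "vertical_connection q R \<longleftrightarrow> tangent_display_map X q \<and>
     (let E = Src X q
      in R \<in> hom X (Tob X E) (Vob q) \<and>
         iota q \<cdot> R = Idn X (Vob q) \<and>
         linear_morphism (tangent_bundle X E) (vertical_bundle q) (Idn X E) R)"

definition horizontal_connection :: "'a \<Rightarrow> 'a \<Rightarrow> bool" where
  "horizontal_connection q H \<longleftrightarrow> tangent_display_map X q \<and>
     (let E = Src X q
      in H \<in> hom X (Fob q) (Tob X E) \<and>
         H \<cdot> descent q = Idn X (Fob q) \<and>
         linear_morphism (finsler_bundle q) (tangent_bundle X E) (Idn X E) H)"

definition connection_form :: "'a \<Rightarrow> 'a \<Rightarrow> 'a" where
  "connection_form q H = descent q \<cdot> H"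

definition full_horizontal_connection :: "'a \<Rightarrow> 'a \<Rightarrow> bool" where
  "full_horizontal_connection q H \<longleftrightarrow> horizontal_connection q H \<and>
     (let E = Src X q; V = vertical_bundle q; F = finsler_bundle q;
          P = tangent_bundle X E; Z = trivial_bundle E
      in is_pushout (DB E) (Z, zero V, V) (Z, zero F, F) (V, iota q, P) (F, H, P))"

definition ehresmann_connection :: "'a \<Rightarrow> 'a \<Rightarrow> 'a \<Rightarrow> bool" where
  "ehresmann_connection q R H \<longleftrightarrow> vertical_connection q R \<and> horizontal_connection q H \<and>
     H \<cdot> R = projF q \<cdot> zero (vertical_bundle q) \<and>
     (let E = Src X q
      in pairing X (tpr1 X E) (tpr2 X E) (R \<cdot> iota q) (descent q \<cdot> H) \<cdot> ts X E
           = Idn X (Tob X E))"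

definition abstract_horizontal_connection :: "'a \<Rightarrow> 'a \<Rightarrow> bool" where
  "abstract_horizontal_connection q \<psi> \<longleftrightarrow> tangent_display_map X q \<and>
     (let E = Src X q; V = vertical_bundle q; P = tangent_bundle X E
      in \<psi> \<in> hom X (Tob X E) (Tob X E) \<and>
         \<psi> \<cdot> \<psi> = \<psi> \<and>
         linear_morphism P P (Idn X E) \<psi> \<and>
         is_pushout (DB E) (V, projV q \<cdot> zero V, V) (V, iota q, P) (V, iota q, P) (P, \<psi>, P))"

definition split_abstract_horizontal_connection :: "'a \<Rightarrow> 'a \<Rightarrow> bool" where
  "split_abstract_horizontal_connection q \<psi> \<longleftrightarrow> abstract_horizontal_connection q \<psi> \<and>
     (let E = Src X q; P = tangent_bundle X E; D = DB E
      in \<exists>r \<in> Ob D. \<exists>\<sigma> \<in> hom D r P. \<exists>\<rho> \<in> hom D P r.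
           \<sigma> \<cdot>\<^bsub>D\<^esub> \<rho> = Idn D r \<and> \<rho> \<cdot>\<^bsub>D\<^esub> \<sigma> = (P, \<psi>, P))"

end

end

theory Submission
  imports Defs
begin

text \<open>Linear morphisms over \<open>E\<close> have zero maps, and parallel ones can be added fibrewise.  In the
  resulting category, being a submersion says that the horizontal descent \<open>\<pi> : P \<rightarrow> F\<close> is a cokernel
  of \<open>\<iota> : V \<rightarrow> P\<close>, where \<open>P\<close>, \<open>V\<close>, \<open>F\<close> are the tangent, vertical and Finsler bundles, and a
  horizontal connection \<open>H\<close> is full exactly when \<open>P\<close> is a coproduct of \<open>V\<close> and \<open>F\<close> along \<open>\<iota>\<close> and
  \<open>H\<close>.  Granted this, the theorem is an argument about split exact sequences, using addition but
  never subtraction: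

  \<^item> Let \<open>\<psi>\<close> be an abstract horizontal connection.  It kills \<open>\<iota>\<close>, so \<open>\<psi> = \<pi> H\<close> for a unique \<open>H\<close>.
    The pushout property, applied to the pair \<open>0, \<pi>\<close>, shows that \<open>\<pi>\<close> factors through the idempotent
    \<open>\<psi>\<close>; hence \<open>\<psi> \<pi> = \<pi>\<close>, and \<open>H \<pi> = id\<close> because \<open>\<pi>\<close> is epic.  Maps out of \<open>P\<close> that kill \<open>\<iota>\<close> are the
    same as maps out of \<open>F\<close>, and this turns the pushout for \<open>\<psi>\<close> into the coproduct property of \<open>H\<close>
    (\<open>abstract_imp_full\<close>) and back (\<open>full_imp_split\<close>); \<open>\<psi>\<close> splits through \<open>F\<close>.

  \<^item> If \<open>H\<close> is full, let \<open>R\<close> be the copairing of \<open>id\<close> and \<open>0\<close>.  The sum \<open>R \<iota> + \<pi> H\<close> agrees with the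
    identity after \<open>\<iota>\<close> and after \<open>H\<close>, so it is the identity (\<open>full_imp_ehresmann\<close>).

  \<^item> If \<open>(R, H)\<close> is an Ehresmann connection, the copairing of \<open>r\<close> and \<open>s\<close> is \<open>R r + \<pi> s\<close>.  It is the
    only candidate since \<open>h = (R \<iota> + \<pi> H) h = R (\<iota> h) + \<pi> (H h)\<close> (\<open>ehresmann_imp_full\<close>).

  The last computation needs \<open>h\<close> to be additive.  Linearity of \<open>h\<close> only asks for compatibility with
  lifts; that it implies additivity is \<open>linear_fsum\<close>, which rests on the lift being monic
  (\<open>lift_cancel\<close>), a consequence of its universal property.\<close>

section \<open>Pairing into pullbacks\<close>

lemma hom_Src: "f \<in> hom X A B \<Longrightarrow> Src X f = A"
  and hom_Tgt: "f \<in> hom X A B \<Longrightarrow> Tgt X f = B"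
  and hom_Ar: "f \<in> hom X A B \<Longrightarrow> f \<in> Ar X"
  by (auto simp: hom_def)

context category
begin

lemma hom_Ob:
  assumes "f \<in> hom X A B"
  shows "A \<in> Ob X" "B \<in> Ob X"
  using assms Src_Ob Tgt_Ob by (auto simp: hom_def)

lemma pullback_ext:
  assumes pb: "is_pullback X p1 p2 f g"
    and u: "u \<in> hom X Y (Src X p1)" and v: "v \<in> hom X Y (Src X p1)"
    and "u \<cdot> p1 = v \<cdot> p1" "u \<cdot> p2 = v \<cdot> p2"
  shows "u = v"
proof -
  have p: "p1 \<in> hom X (Src X p1) (Src X f)" "p2 \<in> hom X (Src X p1) (Src X g)" "p1 \<cdot> f = p2 \<cdot> g"
    and fg: "f \<in> hom X (Src X f) (Tgt X f)" "g \<in> hom X (Src X g) (Tgt X f)"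
    using pb by (auto simp: is_pullback_def hom_def)
  have "(v \<cdot> p1) \<cdot> f = (v \<cdot> p2) \<cdot> g"
    using Cmp_assoc[OF v p(1) fg(1)] Cmp_assoc[OF v p(2) fg(2)] p(3) by simp
  moreover have "v \<cdot> p1 \<in> hom X Y (Src X f)" "v \<cdot> p2 \<in> hom X Y (Src X g)"
    using Cmp_hom v p by blast+
  ultimately have "\<exists>!w. w \<in> hom X Y (Src X p1) \<and> w \<cdot> p1 = v \<cdot> p1 \<and> w \<cdot> p2 = v \<cdot> p2"
    using pb unfolding is_pullback_def by blast
  then show ?thesis using assms by blast
qed

lemma pairing_props:
  assumes pb: "is_pullback X p1 p2 f g"
    and a: "a \<in> hom X Y (Src X f)" and b: "b \<in> hom X Y (Src X g)" and "a \<cdot> f = b \<cdot> g"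
  shows pairing_hom: "pairing X p1 p2 a b \<in> hom X Y (Src X p1)"
    and pairing_pr1: "pairing X p1 p2 a b \<cdot> p1 = a"
    and pairing_pr2: "pairing X p1 p2 a b \<cdot> p2 = b"
proof -
  have "\<exists>!u. u \<in> hom X Y (Src X p1) \<and> u \<cdot> p1 = a \<and> u \<cdot> p2 = b"
    using assms unfolding is_pullback_def by blast
  from theI'[OF this]
  show "pairing X p1 p2 a b \<in> hom X Y (Src X p1)"
    and "pairing X p1 p2 a b \<cdot> p1 = a" and "pairing X p1 p2 a b \<cdot> p2 = b"
    by (auto simp: pairing_def hom_Src[OF a])
qed

lemma pairing_eqI:
  assumes pb: "is_pullback X p1 p2 f g"
    and u: "u \<in> hom X Y (Src X p1)"
  shows "pairing X p1 p2 (u \<cdot> p1) (u \<cdot> p2) = u"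
proof -
  have p: "p1 \<in> hom X (Src X p1) (Src X f)" using pb by (simp add: is_pullback_def)
  have "Src X (u \<cdot> p1) = Y" using Cmp_hom[OF u p] by (rule hom_Src)
  then show ?thesis
    unfolding pairing_def using pullback_ext[OF pb] u by (intro the_equality) auto
qed

lemma pairing_precomp:
  assumes pb: "is_pullback X p1 p2 f g"
    and a: "a \<in> hom X Y (Src X f)" and b: "b \<in> hom X Y (Src X g)" and "a \<cdot> f = b \<cdot> g"
    and k: "k \<in> hom X W Y"
  shows "k \<cdot> pairing X p1 p2 a b = pairing X p1 p2 (k \<cdot> a) (k \<cdot> b)"
proof -
  note p = pairing_props[OF assms(1-4)]
  have q: "p1 \<in> hom X (Src X p1) (Src X f)" "p2 \<in> hom X (Src X p1) (Src X g)"
    using pb by (auto simp: is_pullback_def)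
  show ?thesis
    using pairing_eqI[OF pb Cmp_hom[OF k p(1)]] Cmp_assoc[OF k p(1) q(1)] Cmp_assoc[OF k p(1) q(2)]
    by (simp add: p)
qed

end

section \<open>Fibrewise addition\<close>

text \<open>Addition of generalised elements \<open>u, v : Y \<rightarrow> E\<close> of a bundle lying over the same
  \<open>Y \<rightarrow> M\<close>.  The bundle axioms become element-wise laws in this form, with the chosen pullback
  hidden.\<close>

definition fsum :: "('o, 'a, 'm) precat_scheme \<Rightarrow> ('a, 'r) add_bundle_scheme \<Rightarrow> 'a \<Rightarrow> 'a \<Rightarrow> 'a" where
  "fsum X b u v = Cmp X (pairing X (pr1 b) (pr2 b) u v) (add b)"

text \<open>The zero morphism, for bundles over the same base.\<close>

definition null_map :: "('o, 'a, 'm) precat_scheme \<Rightarrow> ('a, 'r) add_bundle_scheme \<Rightarrow> ('a, 's) add_bundle_scheme \<Rightarrow> 'a" where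
  "null_map X b c = Cmp X (proj b) (zero c)"

text \<open>The part of the additive bundle structure that makes sums of generalised elements behave.  It is
  isolated because it passes from a differential bundle to its image under \<open>T\<close> using only
  that \<open>T\<close> is a functor preserving the chosen pullback.\<close>

definition has_fsum :: "('o, 'a, 'm) precat_scheme \<Rightarrow> ('a, 'r) add_bundle_scheme \<Rightarrow> bool" where
  "has_fsum X b \<longleftrightarrow> is_pullback X (pr1 b) (pr2 b) (proj b) (proj b) \<and>
     add b \<in> hom X (Src X (pr1 b)) (Src X (proj b)) \<and>
     Cmp X (add b) (proj b) = Cmp X (pr1 b) (proj b)"

context category
begin

lemma fsum_props:
  assumes b: "has_fsum X b"
    and u: "u \<in> hom X Y (Src X (proj b))" and v: "v \<in> hom X Y (Src X (proj b))"
    and uv: "u \<cdot> proj b = v \<cdot> proj b"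
  shows fsum_hom: "fsum X b u v \<in> hom X Y (Src X (proj b))"
    and fsum_proj: "fsum X b u v \<cdot> proj b = u \<cdot> proj b"
    and fsum_precomp: "k \<in> hom X W Y \<Longrightarrow> k \<cdot> fsum X b u v = fsum X b (k \<cdot> u) (k \<cdot> v)"
proof -
  have pb: "is_pullback X (pr1 b) (pr2 b) (proj b) (proj b)"
    and s: "add b \<in> hom X (Src X (pr1 b)) (Src X (proj b))"
    and sq: "add b \<cdot> proj b = pr1 b \<cdot> proj b"
    using b by (auto simp: has_fsum_def)
  have pr: "pr1 b \<in> hom X (Src X (pr1 b)) (Src X (proj b))"
    and q: "proj b \<in> hom X (Src X (proj b)) (Tgt X (proj b))"
    using pb by (auto simp: is_pullback_def hom_def)
  note p = pairing_props[OF pb u v uv]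
  show "fsum X b u v \<in> hom X Y (Src X (proj b))"
    unfolding fsum_def using p(1) s by (rule Cmp_hom)
  show "fsum X b u v \<cdot> proj b = u \<cdot> proj b"
    unfolding fsum_def
    using Cmp_assoc[OF p(1) s q] Cmp_assoc[OF p(1) pr q] p(2) sq by simp
  assume k: "k \<in> hom X W Y"
  show "k \<cdot> fsum X b u v = fsum X b (k \<cdot> u) (k \<cdot> v)"
    unfolding fsum_def
    using Cmp_assoc[OF k p(1) s] pairing_precomp[OF pb u v uv k] by simp
qed

lemma additive_bundle_has_fsum: "additive_bundle X b \<Longrightarrow> has_fsum X b"
  unfolding additive_bundle_def has_fsum_def Let_def by blast

lemma additive_bundleD:
  assumes b: "additive_bundle X b"
  shows "proj b \<in> hom X (Src X (proj b)) (Tgt X (proj b))"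
    and "zero b \<in> hom X (Tgt X (proj b)) (Src X (proj b))"
    and "zero b \<cdot> proj b = Idn X (Tgt X (proj b))"
    and "fsum X b (Idn X (Src X (proj b))) (proj b \<cdot> zero b) = Idn X (Src X (proj b))"
    and "fsum X b (pr2 b) (pr1 b) = add b"
proof -
  have "is_pullback X (pr1 b) (pr2 b) (proj b) (proj b)"
    using b unfolding additive_bundle_def Let_def by blast
  then have "proj b \<in> Ar X" by (simp add: is_pullback_def)
  then show "proj b \<in> hom X (Src X (proj b)) (Tgt X (proj b))" by (simp add: hom_def)
  show "zero b \<in> hom X (Tgt X (proj b)) (Src X (proj b))"
    and "zero b \<cdot> proj b = Idn X (Tgt X (proj b))"
    and "fsum X b (Idn X (Src X (proj b))) (proj b \<cdot> zero b) = Idn X (Src X (proj b))"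
    and "fsum X b (pr2 b) (pr1 b) = add b"
    using b unfolding additive_bundle_def Let_def fsum_def by blast+
qed

lemma fsum_zero_right:
  assumes b: "additive_bundle X b" and u: "u \<in> hom X Y (Src X (proj b))"
  shows "fsum X b u ((u \<cdot> proj b) \<cdot> zero b) = u"
proof -
  have q: "proj b \<in> hom X (Src X (proj b)) (Tgt X (proj b))"
    and z: "zero b \<in> hom X (Tgt X (proj b)) (Src X (proj b))"
    and zq: "zero b \<cdot> proj b = Idn X (Tgt X (proj b))"
    and unit: "fsum X b (Idn X (Src X (proj b))) (proj b \<cdot> zero b) = Idn X (Src X (proj b))"
    using additive_bundleD[OF b] by simp_all
  have i: "Idn X (Src X (proj b)) \<in> hom X (Src X (proj b)) (Src X (proj b))"
    using hom_Ob[OF q] Idn_hom by blast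
  have qz: "proj b \<cdot> zero b \<in> hom X (Src X (proj b)) (Src X (proj b))"
    using Cmp_hom[OF q z] .
  have "Idn X (Src X (proj b)) \<cdot> proj b = (proj b \<cdot> zero b) \<cdot> proj b"
    using Idn_left[OF q] Cmp_assoc[OF q z q] Idn_right[OF q] zq by simp
  from fsum_precomp[OF additive_bundle_has_fsum[OF b] i qz this u]
  show ?thesis
    using unit Idn_right[OF u] Cmp_assoc[OF u q z] by simp
qed

lemma fsum_commute:
  assumes b: "additive_bundle X b"
    and u: "u \<in> hom X Y (Src X (proj b))" and v: "v \<in> hom X Y (Src X (proj b))"
    and uv: "u \<cdot> proj b = v \<cdot> proj b"
  shows "fsum X b u v = fsum X b v u"
proof -
  have pb: "is_pullback X (pr1 b) (pr2 b) (proj b) (proj b)"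
    and c: "fsum X b (pr2 b) (pr1 b) = add b"
    using additive_bundle_has_fsum[OF b] additive_bundleD(5)[OF b]
    by (simp_all add: has_fsum_def)
  have pr: "pr2 b \<in> hom X (Src X (pr1 b)) (Src X (proj b))"
      "pr1 b \<in> hom X (Src X (pr1 b)) (Src X (proj b))" "pr2 b \<cdot> proj b = pr1 b \<cdot> proj b"
    using pb by (auto simp: is_pullback_def hom_def)
  note p = pairing_props[OF pb u v uv]
  show ?thesis
    using fsum_precomp[OF additive_bundle_has_fsum[OF b] pr p(1)] c p(2,3)
    by (simp add: fsum_def)
qed

lemma fsum_zero_left:
  assumes b: "additive_bundle X b" and u: "u \<in> hom X Y (Src X (proj b))"
  shows "fsum X b ((u \<cdot> proj b) \<cdot> zero b) u = u"
proof -
  have q: "proj b \<in> hom X (Src X (proj b)) (Tgt X (proj b))"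
    and z: "zero b \<in> hom X (Tgt X (proj b)) (Src X (proj b))"
    and zq: "zero b \<cdot> proj b = Idn X (Tgt X (proj b))"
    using additive_bundleD[OF b] by simp_all
  have uq: "u \<cdot> proj b \<in> hom X Y (Tgt X (proj b))" using Cmp_hom[OF u q] .
  have "u \<cdot> proj b = ((u \<cdot> proj b) \<cdot> zero b) \<cdot> proj b"
    using Cmp_assoc[OF uq z q] zq Idn_right[OF uq] by simp
  from fsum_commute[OF b u Cmp_hom[OF uq z] this] show ?thesis
    using fsum_zero_right[OF b u] by simp
qed

text \<open>Preservation of the addition map is preservation of the sum of the two projections, the universal
  pair of summable elements; precomposing gives all other pairs.\<close>

lemma additive_morphism_fsum:
  assumes b: "has_fsum X b" and c: "has_fsum X c" and g: "additive_morphism X b c f g"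
    and u: "u \<in> hom X Y (Src X (proj b))" and v: "v \<in> hom X Y (Src X (proj b))"
    and uv: "u \<cdot> proj b = v \<cdot> proj b"
  shows "fsum X b u v \<cdot> g = fsum X c (u \<cdot> g) (v \<cdot> g)"
proof -
  have pb: "is_pullback X (pr1 b) (pr2 b) (proj b) (proj b)"
    and s: "add b \<in> hom X (Src X (pr1 b)) (Src X (proj b))"
    using b by (auto simp: has_fsum_def)
  have pr: "pr1 b \<in> hom X (Src X (pr1 b)) (Src X (proj b))"
      "pr2 b \<in> hom X (Src X (pr1 b)) (Src X (proj b))" "pr1 b \<cdot> proj b = pr2 b \<cdot> proj b"
    and q: "proj b \<in> hom X (Src X (proj b)) (Tgt X (proj b))"
    using pb by (auto simp: is_pullback_def hom_def)
  have gh: "g \<in> hom X (Src X (proj b)) (Src X (proj c))"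
    and f: "f \<in> hom X (Tgt X (proj b)) (Tgt X (proj c))"
    and gf: "g \<cdot> proj c = proj b \<cdot> f"
    and sg: "add b \<cdot> g = fsum X c (pr1 b \<cdot> g) (pr2 b \<cdot> g)"
    using g by (auto simp: additive_morphism_def fsum_def)
  have qc: "proj c \<in> hom X (Src X (proj c)) (Tgt X (proj c))"
    using c by (auto simp: has_fsum_def is_pullback_def hom_def)
  note p = pairing_props[OF pb u v uv]
  have e: "(pr1 b \<cdot> g) \<cdot> proj c = (pr2 b \<cdot> g) \<cdot> proj c"
    using Cmp_assoc[OF pr(1) gh qc] Cmp_assoc[OF pr(2) gh qc]
      Cmp_assoc[OF pr(1) q f] Cmp_assoc[OF pr(2) q f] gf pr(3) by simp
  have "fsum X b u v \<cdot> g = pairing X (pr1 b) (pr2 b) u v \<cdot> fsum X c (pr1 b \<cdot> g) (pr2 b \<cdot> g)"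
    unfolding fsum_def[of X b] using Cmp_assoc[OF p(1) s gh] sg by simp
  also have "\<dots> = fsum X c (u \<cdot> g) (v \<cdot> g)"
    using fsum_precomp[OF c Cmp_hom[OF pr(1) gh] Cmp_hom[OF pr(2) gh] e p(1)]
      Cmp_assoc[OF p(1) pr(1) gh] Cmp_assoc[OF p(1) pr(2) gh] p(2,3) by simp
  finally show ?thesis .
qed

end

section \<open>Linear morphisms are additive\<close>

context tangent_category
begin

lemma Src_Tar: "f \<in> Ar X \<Longrightarrow> Src X (Tar X f) = Tob X (Src X f)"
  using Tar_hom[of f "Src X f" "Tgt X f"] by (auto simp: hom_def)

lemma tangent_pullback_Tar:
  assumes "tangent_pullback X p1 p2 f g"
  shows "is_pullback X p1 p2 f g" "is_pullback X (Tar X p1) (Tar X p2) (Tar X f) (Tar X g)"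
  using assms unfolding tangent_pullback_def by (metis funpow_0, metis funpow_0 funpow.simps(2) comp_apply)

lemma T_bundle_has_fsum:
  assumes b: "differential_bundle X b"
  shows "has_fsum X (T_bundle X b)"
proof -
  have h: "has_fsum X b"
    using b by (auto simp: differential_bundle_def Let_def intro: additive_bundle_has_fsum)
  have pb: "is_pullback X (Tar X (pr1 b)) (Tar X (pr2 b)) (Tar X (proj b)) (Tar X (proj b))"
    using b by (auto simp: differential_bundle_def Let_def intro: tangent_pullback_Tar)
  have s: "add b \<in> hom X (Src X (pr1 b)) (Src X (proj b))"
    and p: "pr1 b \<in> hom X (Src X (pr1 b)) (Src X (proj b))"
    and q: "proj b \<in> hom X (Src X (proj b)) (Tgt X (proj b))"
    and sq: "add b \<cdot> proj b = pr1 b \<cdot> proj b"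
    using h by (auto simp: has_fsum_def is_pullback_def hom_def)
  show ?thesis
    unfolding has_fsum_def T_bundle_def
    using pb Tar_hom[OF s] Tar_Cmp[OF s q] Tar_Cmp[OF p q] sq hom_Ar[OF p] hom_Ar[OF q]
    by (simp add: Src_Tar)
qed

lemma Tar_fsum:
  assumes b: "differential_bundle X b"
    and u: "u \<in> hom X Y (Src X (proj b))" and v: "v \<in> hom X Y (Src X (proj b))"
    and uv: "u \<cdot> proj b = v \<cdot> proj b"
  shows "Tar X (fsum X b u v) = fsum X (T_bundle X b) (Tar X u) (Tar X v)"
proof -
  have h: "has_fsum X b"
    using b by (auto simp: differential_bundle_def Let_def intro: additive_bundle_has_fsum)
  have pb: "is_pullback X (pr1 b) (pr2 b) (proj b) (proj b)"
    and s: "add b \<in> hom X (Src X (pr1 b)) (Src X (proj b))"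
    and pr: "pr1 b \<in> hom X (Src X (pr1 b)) (Src X (proj b))"
      "pr2 b \<in> hom X (Src X (pr1 b)) (Src X (proj b))"
    using h by (auto simp: has_fsum_def is_pullback_def)
  have Tpb: "is_pullback X (Tar X (pr1 b)) (Tar X (pr2 b)) (Tar X (proj b)) (Tar X (proj b))"
    using T_bundle_has_fsum[OF b] by (simp add: has_fsum_def T_bundle_def)
  note p = pairing_props[OF pb u v uv]
  have "Tar X (pairing X (pr1 b) (pr2 b) u v) \<in> hom X (Tob X Y) (Src X (Tar X (pr1 b)))"
    using Tar_hom[OF p(1)] hom_Ar[OF pr(1)] by (simp add: Src_Tar)
  from pairing_eqI[OF Tpb this]
  have "Tar X (pairing X (pr1 b) (pr2 b) u v)
      = pairing X (Tar X (pr1 b)) (Tar X (pr2 b)) (Tar X u) (Tar X v)"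
    using Tar_Cmp[OF p(1) pr(1)] Tar_Cmp[OF p(1) pr(2)] p(2,3) by simp
  then show ?thesis
    using Tar_Cmp[OF p(1) s] by (simp add: fsum_def T_bundle_def)
qed

lemma differential_bundleD:
  assumes b: "differential_bundle X b"
  shows "additive_bundle X b"
    and "has_fsum X b"
    and "proj b \<in> hom X (Src X (proj b)) (Tgt X (proj b))"
    and "zero b \<in> hom X (Tgt X (proj b)) (Src X (proj b))"
    and "zero b \<cdot> proj b = Idn X (Tgt X (proj b))"
    and "lift b \<in> hom X (Src X (proj b)) (Tob X (Src X (proj b)))"
    and "lift b \<cdot> Tar X (proj b) = proj b \<cdot> tz X (Tgt X (proj b))"
    and "lift b \<cdot> tp X (Src X (proj b)) = proj b \<cdot> zero b"
    and "zero b \<cdot> lift b = zero b \<cdot> tz X (Src X (proj b))"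
    and "Src X (proj b) \<in> Ob X"
    and "Tgt X (proj b) \<in> Ob X"
proof -
  show a: "additive_bundle X b" using b by (simp add: differential_bundle_def Let_def)
  show "has_fsum X b" using a by (rule additive_bundle_has_fsum)
  show q: "proj b \<in> hom X (Src X (proj b)) (Tgt X (proj b))"
    using additive_bundleD(1)[OF a] .
  show "zero b \<in> hom X (Tgt X (proj b)) (Src X (proj b))"
    and "zero b \<cdot> proj b = Idn X (Tgt X (proj b))"
    using additive_bundleD(2,3)[OF a] .
  have l: "additive_morphism X b (T_bundle X b) (tz X (Tgt X (proj b))) (lift b)"
    and l': "additive_morphism X b (tangent_bundle X (Src X (proj b))) (zero b) (lift b)"
    using b by (auto simp: differential_bundle_def Let_def)
  show "lift b \<in> hom X (Src X (proj b)) (Tob X (Src X (proj b)))"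
    using l hom_Ar[OF q] by (simp add: additive_morphism_def T_bundle_def Src_Tar)
  show "lift b \<cdot> Tar X (proj b) = proj b \<cdot> tz X (Tgt X (proj b))"
    using l by (simp add: additive_morphism_def T_bundle_def)
  show "lift b \<cdot> tp X (Src X (proj b)) = proj b \<cdot> zero b"
    and "zero b \<cdot> lift b = zero b \<cdot> tz X (Src X (proj b))"
    using l' by (simp_all add: additive_morphism_def tangent_bundle_def)
  show "Src X (proj b) \<in> Ob X" "Tgt X (proj b) \<in> Ob X" using hom_Ob[OF q] .
qed

lemma tangent_bundle_simps [simp]:
  "proj (tangent_bundle X M) = tp X M" "zero (tangent_bundle X M) = tz X M"
  "add (tangent_bundle X M) = ts X M" "lift (tangent_bundle X M) = tl X M"
  "pr1 (tangent_bundle X M) = tpr1 X M" "pr2 (tangent_bundle X M) = tpr2 X M"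
  by (simp_all add: tangent_bundle_def)

lemma tz_tp: "M \<in> Ob X \<Longrightarrow> tz X M \<cdot> tp X M = Idn X M"
  using additive_bundleD(3)[OF tangent_additive[of M]] tp_hom[of M]
  by (simp add: hom_def)

text \<open>This only reassembles the naturality of \<open>p\<close>, \<open>z\<close> and \<open>s\<close>.\<close>

lemma Tar_additive:
  assumes f: "f \<in> hom X M N"
  shows "additive_morphism X (tangent_bundle X M) (tangent_bundle X N) f (Tar X f)"
  using tp_nat[OF f] tz_nat[OF f] ts_nat[OF f] f Tar_hom[OF f] hom_Ob[OF f]
    tp_hom[of M] tp_hom[of N]
  by (simp add: additive_morphism_def hom_Src hom_Tgt)

text \<open>The lift is monic.  It factors through the pullback projection \<open>\<xi>\<close> as \<open>l = \<langle>id, q z\<rangle> \<xi>\<close>, because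
  the second summand in \<open>\<langle>id, q z\<rangle> \<xi>\<close> is the zero of \<open>T q\<close> over the base point of \<open>l\<close>.  As \<open>u l\<close>
  also determines \<open>u q\<close>, both pullback projections of \<open>u \<langle>id, q z\<rangle>\<close> are determined by \<open>u l\<close>, and
  \<open>u\<close> is the first component of that pair.\<close>

lemma lift_cancel:
  assumes b: "differential_bundle X b"
    and u: "u \<in> hom X Y (Src X (proj b))" and v: "v \<in> hom X Y (Src X (proj b))"
    and uv: "u \<cdot> lift b = v \<cdot> lift b"
  shows "u = v"
proof -
  let ?E = "Src X (proj b)" and ?M = "Tgt X (proj b)" and ?B = "T_bundle X b"
  note d = differential_bundleD[OF b]
  note q = d(3) and z = d(4) and l = d(6)
  have pb: "is_pullback X (pr1 b) (pr2 b) (proj b) (proj b)" using d(2) by (simp add: has_fsum_def)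
  have pr: "pr1 b \<in> hom X (Src X (pr1 b)) ?E" "pr2 b \<in> hom X (Src X (pr1 b)) ?E"
    "pr1 b \<cdot> proj b = pr2 b \<cdot> proj b"
    using pb by (auto simp: is_pullback_def)
  have tM: "tz X ?M \<in> hom X ?M (Tob X ?M)" "tp X ?M \<in> hom X (Tob X ?M) ?M"
    and tE: "tz X ?E \<in> hom X ?E (Tob X ?E)"
    using tz_hom tp_hom d(10,11) by auto
  have i: "Idn X ?E \<in> hom X ?E ?E" using Idn_hom d(10) .
  have qz: "proj b \<cdot> zero b \<in> hom X ?E ?E" using Cmp_hom[OF q z] .
  have iq: "Idn X ?E \<cdot> proj b = (proj b \<cdot> zero b) \<cdot> proj b"
    using Idn_left[OF q] Cmp_assoc[OF q z q] Idn_right[OF q] d(5) by simp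
  define k where "k = pairing X (pr1 b) (pr2 b) (Idn X ?E) (proj b \<cdot> zero b)"
  have k: "k \<in> hom X ?E (Src X (pr1 b))" "k \<cdot> pr1 b = Idn X ?E" "k \<cdot> pr2 b = proj b \<cdot> zero b"
    using pairing_props[OF pb i qz iq] by (simp_all add: k_def)
  have xi: "xi X b = fsum X ?B (pr1 b \<cdot> lift b) (pr2 b \<cdot> tz X ?E)"
    by (simp add: xi_def fsum_def T_bundle_def)
  have univ: "is_pullback X (xi X b) (pr1 b \<cdot> proj b) (Tar X (proj b)) (tz X ?M)"
    using b by (auto simp: differential_bundle_def xi_universal_def Let_def
        intro: tangent_pullback_Tar)
  have Tq: "Tar X (proj b) \<in> hom X (Tob X ?E) (Tob X ?M)"
    and Tz: "Tar X (zero b) \<in> hom X (Tob X ?M) (Tob X ?E)"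
    using Tar_hom q z by auto
  have projB: "proj ?B = Tar X (proj b)" "Src X (Tar X (proj b)) = Tob X ?E"
    using hom_Src[OF Tq] by (simp_all add: T_bundle_def)
  have pl: "pr1 b \<cdot> lift b \<in> hom X (Src X (pr1 b)) (Src X (proj ?B))"
    and pt: "pr2 b \<cdot> tz X ?E \<in> hom X (Src X (pr1 b)) (Src X (proj ?B))"
    using Cmp_hom[OF pr(1) l] Cmp_hom[OF pr(2) tE] by (simp_all add: projB)
  have plt: "(pr1 b \<cdot> lift b) \<cdot> proj ?B = (pr2 b \<cdot> tz X ?E) \<cdot> proj ?B"
    using Cmp_assoc[OF pr(1) l Tq] Cmp_assoc[OF pr(2) tE Tq] d(7) tz_nat[OF q]
      Cmp_assoc[OF pr(1) q tM(1)] Cmp_assoc[OF pr(2) q tM(1)] pr(3) by (simp add: projB)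
  note hB = T_bundle_has_fsum[OF b]
  have xih: "xi X b \<in> hom X (Src X (pr1 b)) (Tob X ?E)"
    using fsum_hom[OF hB pl pt plt] by (simp add: xi projB)
  have "k \<cdot> xi X b = fsum X ?B (lift b) ((proj b \<cdot> zero b) \<cdot> tz X ?E)"
    using fsum_precomp[OF hB pl pt plt k(1)] Cmp_assoc[OF k(1) pr(1) l]
      Cmp_assoc[OF k(1) pr(2) tE] Idn_left[OF l] by (simp add: xi k)
  \<comment> \<open>the second summand is written as a map factoring through the lift, so that the unit law of the
    bundle can be applied under \<open>T\<close>\<close>
  also have "(proj b \<cdot> zero b) \<cdot> tz X ?E = lift b \<cdot> Tar X (proj b \<cdot> zero b)"
    using Cmp_assoc[OF q z tE] tz_nat[OF z] Tar_Cmp[OF q z] Cmp_assoc[OF l Tq Tz] d(7)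
      Cmp_assoc[OF q tM(1) Tz] by simp
  also have "fsum X ?B (lift b) (lift b \<cdot> Tar X (proj b \<cdot> zero b))
      = lift b \<cdot> fsum X ?B (Tar X (Idn X ?E)) (Tar X (proj b \<cdot> zero b))"
  proof -
    have 1: "Tar X (Idn X ?E) \<in> hom X (Tob X ?E) (Src X (proj ?B))"
      "Tar X (proj b \<cdot> zero b) \<in> hom X (Tob X ?E) (Src X (proj ?B))"
      using Tar_hom i qz by (auto simp: projB)
    have 2: "Tar X (Idn X ?E) \<cdot> proj ?B = Tar X (proj b \<cdot> zero b) \<cdot> proj ?B"
      using Tar_Cmp[OF i q] Tar_Cmp[OF qz q] iq by (simp add: projB)
    show ?thesis
      using fsum_precomp[OF hB 1 2 l] Tar_Idn[OF d(10)] Idn_right[OF l] by simp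
  qed
  also have "fsum X ?B (Tar X (Idn X ?E)) (Tar X (proj b \<cdot> zero b)) = Idn X (Tob X ?E)"
    using Tar_fsum[OF b i qz iq] fsum_zero_right[OF d(1) i] Idn_left[OF q] Tar_Idn[OF d(10)]
    by simp
  also have "lift b \<cdot> Idn X (Tob X ?E) = lift b" using Idn_right[OF l] .
  finally have kxi: "k \<cdot> xi X b = lift b" .
  \<comment> \<open>the lift remembers the base point: \<open>l (T q) p = q z p = q\<close>\<close>
  have base: "w \<cdot> proj b = (w \<cdot> lift b) \<cdot> (Tar X (proj b) \<cdot> tp X ?M)"
    if w: "w \<in> hom X Y ?E" for w
  proof -
    have wq: "w \<cdot> proj b \<in> hom X Y ?M" using Cmp_hom[OF w q] .
    have "(w \<cdot> lift b) \<cdot> (Tar X (proj b) \<cdot> tp X ?M) = ((w \<cdot> proj b) \<cdot> tz X ?M) \<cdot> tp X ?M"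
      using Cmp_assoc[OF Cmp_hom[OF w l] Tq tM(2)] Cmp_assoc[OF w l Tq] d(7)
        Cmp_assoc[OF w q tM(1)] by simp
    also have "\<dots> = w \<cdot> proj b"
      using Cmp_assoc[OF wq tM] tz_tp[OF d(11)] Idn_right[OF wq] by simp
    finally show ?thesis by simp
  qed
  have uvq: "u \<cdot> proj b = v \<cdot> proj b" using base[OF u] base[OF v] uv by simp
  have sx: "Src X (xi X b) = Src X (pr1 b)" using hom_Src[OF xih] .
  have wk: "w \<cdot> k \<in> hom X Y (Src X (xi X b))" "(w \<cdot> k) \<cdot> xi X b = w \<cdot> lift b"
      "(w \<cdot> k) \<cdot> (pr1 b \<cdot> proj b) = w \<cdot> proj b" "(w \<cdot> k) \<cdot> pr1 b = w"
    if w: "w \<in> hom X Y ?E" for w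
  proof -
    show "w \<cdot> k \<in> hom X Y (Src X (xi X b))" using Cmp_hom[OF w k(1)] sx by simp
    show "(w \<cdot> k) \<cdot> xi X b = w \<cdot> lift b" using Cmp_assoc[OF w k(1) xih] kxi by simp
    show e: "(w \<cdot> k) \<cdot> pr1 b = w" using Cmp_assoc[OF w k(1) pr(1)] k(2) Idn_right[OF w] by simp
    show "(w \<cdot> k) \<cdot> (pr1 b \<cdot> proj b) = w \<cdot> proj b"
      using Cmp_assoc[OF Cmp_hom[OF w k(1)] pr(1) q] e by simp
  qed
  have uvk: "u \<cdot> k = v \<cdot> k"
    using pullback_ext[OF univ wk(1)[OF u] wk(1)[OF v]] wk(2,3)[OF u] wk(2,3)[OF v] uv uvq by simp
  have "u = (u \<cdot> k) \<cdot> pr1 b" using wk(4)[OF u] by (rule sym)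
  also have "\<dots> = v" unfolding uvk using wk(4)[OF v] .
  finally show ?thesis .
qed

text \<open>Linear morphisms are additive.  Both sides are compared after the monic lift of the target.
  Using the additive morphism \<open>l : q \<rightarrow> T q\<close> here would be circular, as it would require \<open>T g\<close> to
  preserve sums in the fibres of \<open>T q\<close>.  The additive morphism \<open>l : q \<rightarrow> p\<close> instead turns sums in
  the bundle into sums of tangent vectors, which every map \<open>T g\<close> preserves by naturality of \<open>s\<close>.\<close>

lemma linear_fsum:
  assumes b: "differential_bundle X b" and c: "differential_bundle X c"
    and g: "linear_morphism X b c f g"
    and u: "u \<in> hom X Y (Src X (proj b))" and v: "v \<in> hom X Y (Src X (proj b))"
    and uv: "u \<cdot> proj b = v \<cdot> proj b"
  shows "fsum X b u v \<cdot> g = fsum X c (u \<cdot> g) (v \<cdot> g)"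
proof -
  let ?E = "Src X (proj b)" and ?E' = "Src X (proj c)"
  note db = differential_bundleD[OF b] and dc = differential_bundleD[OF c]
  have gh: "g \<in> hom X ?E ?E'" and gq: "g \<cdot> proj c = proj b \<cdot> f"
    and f: "f \<in> hom X (Tgt X (proj b)) (Tgt X (proj c))"
    and gl: "g \<cdot> lift c = lift b \<cdot> Tar X g"
    using g by (auto simp: linear_morphism_def)
  have Tg: "Tar X g \<in> hom X (Tob X ?E) (Tob X ?E')" using Tar_hom[OF gh] .
  have tb: "has_fsum X (tangent_bundle X ?E)" and tc: "has_fsum X (tangent_bundle X ?E')"
    using additive_bundle_has_fsum tangent_additive db(10) dc(10) by blast+
  have lb: "additive_morphism X b (tangent_bundle X ?E) (zero b) (lift b)"
    and lc: "additive_morphism X c (tangent_bundle X ?E') (zero c) (lift c)"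
    using b c by (auto simp: differential_bundle_def Let_def)
  have s: "fsum X b u v \<in> hom X Y ?E" using fsum_hom[OF db(2) u v uv] .
  have tp: "tp X ?E \<in> hom X (Tob X ?E) ?E" using tp_hom db(10) .
  have ug: "u \<cdot> g \<in> hom X Y ?E'" "v \<cdot> g \<in> hom X Y ?E'" using Cmp_hom gh u v by blast+
  have ugq: "(u \<cdot> g) \<cdot> proj c = (v \<cdot> g) \<cdot> proj c"
    using Cmp_assoc[OF u gh dc(3)] Cmp_assoc[OF v gh dc(3)] gq
      Cmp_assoc[OF u db(3) f] Cmp_assoc[OF v db(3) f] uv by simp
  have ul: "u \<cdot> lift b \<in> hom X Y (Src X (proj (tangent_bundle X ?E)))"
      "v \<cdot> lift b \<in> hom X Y (Src X (proj (tangent_bundle X ?E)))"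
    using Cmp_hom[OF u db(6)] Cmp_hom[OF v db(6)] hom_Src[OF tp] by simp_all
  have ulp: "(u \<cdot> lift b) \<cdot> proj (tangent_bundle X ?E) = (v \<cdot> lift b) \<cdot> proj (tangent_bundle X ?E)"
    using Cmp_assoc[OF u db(6) tp] Cmp_assoc[OF v db(6) tp] db(8)
      Cmp_assoc[OF u db(3,4)] Cmp_assoc[OF v db(3,4)] uv by simp
  have "(fsum X b u v \<cdot> g) \<cdot> lift c = (fsum X b u v \<cdot> lift b) \<cdot> Tar X g"
    using Cmp_assoc[OF s gh dc(6)] gl Cmp_assoc[OF s db(6) Tg] by simp
  also have "\<dots> = fsum X (tangent_bundle X ?E) (u \<cdot> lift b) (v \<cdot> lift b) \<cdot> Tar X g"
    using additive_morphism_fsum[OF db(2) tb lb u v uv] by simp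
  also have "\<dots> = fsum X (tangent_bundle X ?E') ((u \<cdot> lift b) \<cdot> Tar X g) ((v \<cdot> lift b) \<cdot> Tar X g)"
    using additive_morphism_fsum[OF tb tc Tar_additive[OF gh] ul ulp] .
  also have "\<dots> = fsum X (tangent_bundle X ?E') ((u \<cdot> g) \<cdot> lift c) ((v \<cdot> g) \<cdot> lift c)"
    using Cmp_assoc[OF u db(6) Tg] Cmp_assoc[OF v db(6) Tg]
      Cmp_assoc[OF u gh dc(6)] Cmp_assoc[OF v gh dc(6)] gl by simp
  also have "\<dots> = fsum X c (u \<cdot> g) (v \<cdot> g) \<cdot> lift c"
    using additive_morphism_fsum[OF dc(2) tc lc ug ugq] by simp
  finally show ?thesis
    using lift_cancel[OF c Cmp_hom[OF s gh] fsum_hom[OF dc(2) ug ugq]] by simp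
qed

end

section \<open>The category of differential bundles over a fixed base\<close>

text \<open>Arrows of \<open>DB E\<close> are triples; their sources and targets are moved into the relation so that
  composition is composition of the underlying maps.\<close>

definition linear_over :: "('o, 'a, 'm) tangent_precat_scheme \<Rightarrow> 'o \<Rightarrow>
    'a diff_bundle \<Rightarrow> 'a diff_bundle \<Rightarrow> 'a \<Rightarrow> bool" where
  "linear_over X E b c g \<longleftrightarrow> (b, g, c) \<in> Ar (DB X E)"

lemma linear_over_iff:
  "linear_over X E b c g \<longleftrightarrow> differential_bundle X b \<and> Tgt X (proj b) = E \<and>
     differential_bundle X c \<and> Tgt X (proj c) = E \<and> linear_morphism X b c (Idn X E) g"
  by (auto simp: linear_over_def DB_def Let_def)

lemma DB_hom_iff: "t \<in> hom (DB X E) b c \<longleftrightarrow> (\<exists>g. t = (b, g, c) \<and> linear_over X E b c g)"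
  by (cases t) (auto simp: hom_def linear_over_def DB_def Let_def)

lemma DB_Ar_iff: "(b, g, c) \<in> Ar (DB X E) \<longleftrightarrow> linear_over X E b c g"
  by (simp add: linear_over_def)

lemma DB_simps:
  "Src (DB X E) (b, g, c) = b" "Tgt (DB X E) (b, g, c) = c"
  "Cmp (DB X E) (b, g, c) (d, h, e) = (b, Cmp X g h, e)"
  "Idn (DB X E) b = (b, Idn X (Src X (proj b)), b)"
  by (simp_all add: DB_def Let_def)

lemma is_pushout_DB_iff:
  "is_pushout (DB X E) (b, f, c) (b, g, d) (c, u, e) (d, v, e) \<longleftrightarrow>
     linear_over X E b c f \<and> linear_over X E b d g \<and> linear_over X E c e u \<and> linear_over X E d e v \<and>
     Cmp X f u = Cmp X g v \<and>
     (\<forall>y r s. linear_over X E c y r \<longrightarrow> linear_over X E d y s \<longrightarrow> Cmp X f r = Cmp X g s \<longrightarrow>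
        (\<exists>!h. linear_over X E e y h \<and> Cmp X u h = r \<and> Cmp X v h = s))"
proof -
  have ex: "(\<exists>!t. t \<in> hom (DB X E) e y \<and> Cmp (DB X E) (c, u, e) t = (c, r, y)
        \<and> Cmp (DB X E) (d, v, e) t = (d, s, y)) \<longleftrightarrow>
      (\<exists>!h. linear_over X E e y h \<and> Cmp X u h = r \<and> Cmp X v h = s)" (is "?L \<longleftrightarrow> ?R") for y r s
    unfolding DB_hom_iff Ex1_def by (auto simp: DB_simps)
  have ball: "(\<forall>t \<in> hom (DB X E) x y. P t) \<longleftrightarrow> (\<forall>g. linear_over X E x y g \<longrightarrow> P (x, g, y))"
    for x y P
    by (auto simp: DB_hom_iff)
  show ?thesis
    unfolding is_pushout_def DB_Ar_iff DB_simps ball ex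
    by (auto simp: DB_hom_iff)
qed

context tangent_category
begin

lemma linear_overD:
  assumes "linear_over X E b c g"
  shows "differential_bundle X b" "differential_bundle X c"
    and "Tgt X (proj b) = E" "Tgt X (proj c) = E"
    and "g \<in> hom X (Src X (proj b)) (Src X (proj c))"
    and "g \<cdot> proj c = proj b"
    and "g \<cdot> lift c = lift b \<cdot> Tar X g"
proof -
  show b: "differential_bundle X b" and "differential_bundle X c"
    and E: "Tgt X (proj b) = E" and "Tgt X (proj c) = E"
    and "g \<in> hom X (Src X (proj b)) (Src X (proj c))"
    and "g \<cdot> lift c = lift b \<cdot> Tar X g"
    using assms by (auto simp: linear_over_iff linear_morphism_def)
  show "g \<cdot> proj c = proj b"
    using assms Idn_right[OF differential_bundleD(3)[OF b]] E
    by (simp add: linear_over_iff linear_morphism_def)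
qed

lemma linear_overI:
  assumes b: "differential_bundle X b" and c: "differential_bundle X c"
    and E: "Tgt X (proj b) = E" "Tgt X (proj c) = E"
    and g: "g \<in> hom X (Src X (proj b)) (Src X (proj c))" "g \<cdot> proj c = proj b"
      "g \<cdot> lift c = lift b \<cdot> Tar X g"
  shows "linear_over X E b c g"
proof -
  have "Idn X E \<in> hom X E E"
    using Idn_hom[OF differential_bundleD(11)[OF b]] unfolding E(1) .
  moreover have "g \<cdot> proj c = proj b \<cdot> Idn X E"
    using g(2) Idn_right[OF differential_bundleD(3)[OF b]] unfolding E(1) by (rule trans[OF _ sym])
  ultimately show ?thesis
    unfolding linear_over_iff linear_morphism_def E using b c g by blast
qed

lemma linear_over_Idn:
  assumes b: "differential_bundle X b" "Tgt X (proj b) = E"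
  shows "linear_over X E b b (Idn X (Src X (proj b)))"
proof (rule linear_overI[OF b(1) b(1) b(2) b(2)])
  note db = differential_bundleD[OF b(1)]
  show "Idn X (Src X (proj b)) \<in> hom X (Src X (proj b)) (Src X (proj b))"
    using Idn_hom[OF db(10)] .
  show "Idn X (Src X (proj b)) \<cdot> proj b = proj b" using Idn_left[OF db(3)] .
  show "Idn X (Src X (proj b)) \<cdot> lift b = lift b \<cdot> Tar X (Idn X (Src X (proj b)))"
    unfolding Tar_Idn[OF db(10)] Idn_left[OF db(6)] Idn_right[OF db(6)] ..
qed

lemma linear_over_comp:
  assumes f: "linear_over X E b c f" and g: "linear_over X E c d g"
  shows "linear_over X E b d (f \<cdot> g)"
proof -
  note F = linear_overD[OF f] and G = linear_overD[OF g]
  note db = differential_bundleD[OF F(1)] and dc = differential_bundleD[OF F(2)]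
    and dd = differential_bundleD[OF G(2)]
  have "(f \<cdot> g) \<cdot> lift d = lift b \<cdot> Tar X (f \<cdot> g)"
    using Cmp_assoc[OF F(5) G(5) dd(6)] G(7) Cmp_assoc[OF F(5) dc(6) Tar_hom[OF G(5)]] F(7)
      Cmp_assoc[OF db(6) Tar_hom[OF F(5)] Tar_hom[OF G(5)]] Tar_Cmp[OF F(5) G(5)] by simp
  then show ?thesis
    using F G Cmp_hom[OF F(5) G(5)] Cmp_assoc[OF F(5) G(5) dd(3)] by (intro linear_overI) auto
qed

lemma linear_over_assoc:
  assumes "linear_over X E a b f" "linear_over X E b c g" "linear_over X E c d h"
  shows "(f \<cdot> g) \<cdot> h = f \<cdot> (g \<cdot> h)"
  using Cmp_assoc linear_overD(5) assms by blast

text \<open>On a section \<open>w = z g\<close>, linearity gives \<open>w l = w z\<close>, the second zero being that of the tangent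
  bundle.  Projecting to the total space turns the left side into the zero section and the right
  side into \<open>w\<close>.\<close>

lemma linear_over_zero:
  assumes g: "linear_over X E b c g"
  shows "zero b \<cdot> g = zero c"
proof -
  note G = linear_overD[OF g]
  note db = differential_bundleD[OF G(1)] and dc = differential_bundleD[OF G(2)]
  let ?C = "Src X (proj c)"
  define w where "w = zero b \<cdot> g"
  have wh: "w \<in> hom X E ?C" using Cmp_hom[OF db(4) G(5)] G(3) by (simp add: w_def)
  have tz: "tz X ?C \<in> hom X ?C (Tob X ?C)" and tp: "tp X ?C \<in> hom X (Tob X ?C) ?C"
    and tzb: "tz X (Src X (proj b)) \<in> hom X (Src X (proj b)) (Tob X (Src X (proj b)))"
    using tz_hom tp_hom dc(10) db(10) by auto
  have q: "w \<cdot> proj c = Idn X E"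
    using Cmp_assoc[OF db(4) G(5) dc(3)] G(3,6) db(5) by (simp add: w_def)
  have "w \<cdot> lift c = w \<cdot> tz X ?C"
    using Cmp_assoc[OF db(4) G(5) dc(6)] G(7) Cmp_assoc[OF db(4) db(6) Tar_hom[OF G(5)]] db(9)
      Cmp_assoc[OF db(4) tzb Tar_hom[OF G(5)]] tz_nat[OF G(5)] Cmp_assoc[OF db(4) G(5) tz]
    by (simp add: w_def)
  then have "w \<cdot> (lift c \<cdot> tp X ?C) = w \<cdot> (tz X ?C \<cdot> tp X ?C)"
    using Cmp_assoc[OF wh dc(6) tp] Cmp_assoc[OF wh tz tp] by simp
  then have "w \<cdot> (proj c \<cdot> zero c) = w"
    using dc(8) tz_tp[OF dc(10)] Idn_right[OF wh] by simp
  then show ?thesis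
    using Cmp_assoc[OF wh dc(3,4)] q Idn_left[OF dc(4)] G(4) by (simp add: w_def)
qed

lemma linear_over_null:
  assumes b: "differential_bundle X b" "Tgt X (proj b) = E"
    and c: "differential_bundle X c" "Tgt X (proj c) = E"
  shows "linear_over X E b c (null_map X b c)"
proof -
  note db = differential_bundleD[OF b(1), unfolded b(2)]
    and dc = differential_bundleD[OF c(1), unfolded c(2)]
  have tz: "tz X (Src X (proj c)) \<in> hom X (Src X (proj c)) (Tob X (Src X (proj c)))"
    and tzE: "tz X E \<in> hom X E (Tob X E)"
    using tz_hom dc(10,11) by auto
  note Tq = Tar_hom[OF db(3)] and Tz = Tar_hom[OF dc(4)]
  have "(proj b \<cdot> zero c) \<cdot> lift c = lift b \<cdot> Tar X (proj b \<cdot> zero c)"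
    using Cmp_assoc[OF db(3) dc(4,6)] dc(9) tz_nat[OF dc(4)] Cmp_assoc[OF db(3) tzE Tz] db(7)
      Cmp_assoc[OF db(6) Tq Tz] Tar_Cmp[OF db(3) dc(4)] by simp
  then show ?thesis
    unfolding null_map_def
    using b c Cmp_hom[OF db(3) dc(4)] Cmp_assoc[OF db(3) dc(4,3)] dc(5) Idn_right[OF db(3)]
    by (intro linear_overI) auto
qed

lemma null_map_comp:
  assumes b: "differential_bundle X b" "Tgt X (proj b) = E" and g: "linear_over X E c d g"
  shows "null_map X b c \<cdot> g = null_map X b d"
proof -
  note G = linear_overD[OF g]
  note db = differential_bundleD[OF b(1), unfolded b(2)]
    and dc = differential_bundleD[OF G(1), unfolded G(3)]
  show ?thesis
    using Cmp_assoc[OF db(3) dc(4) G(5)] linear_over_zero[OF g] by (simp add: null_map_def)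
qed

lemma comp_null_map:
  assumes g: "linear_over X E b c g" and d: "differential_bundle X d" "Tgt X (proj d) = E"
  shows "g \<cdot> null_map X c d = null_map X b d"
proof -
  note G = linear_overD[OF g]
  note dc = differential_bundleD[OF G(2), unfolded G(4)]
    and dd = differential_bundleD[OF d(1), unfolded d(2)]
  show ?thesis
    using Cmp_assoc[OF G(5) dc(3) dd(4)] G(6) by (simp add: null_map_def)
qed

text \<open>Closure under sums comes from the additive morphism \<open>l : q \<rightarrow> T q\<close>, which rewrites the lift of a
  sum as a sum in the image bundle; there \<open>T\<close> of a sum is the sum of the images.\<close>

lemma linear_over_fsum:
  assumes u: "linear_over X E b c u" and v: "linear_over X E b c v"
  shows "linear_over X E b c (fsum X c u v)"
proof -
  note U = linear_overD[OF u] and V = linear_overD[OF v]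
  note db = differential_bundleD[OF U(1)] and dc = differential_bundleD[OF U(2)]
  let ?T = "T_bundle X c" and ?C = "Src X (proj c)"
  have uv: "u \<cdot> proj c = v \<cdot> proj c" using U(6) V(6) by simp
  have add: "additive_morphism X c ?T (tz X (Tgt X (proj c))) (lift c)"
    using U(2) by (simp add: differential_bundle_def Let_def)
  have Tq: "Tar X (proj c) \<in> hom X (Tob X ?C) (Tob X (Tgt X (proj c)))" using Tar_hom[OF dc(3)] .
  have pT: "proj ?T = Tar X (proj c)" "Src X (Tar X (proj c)) = Tob X ?C"
    using hom_Src[OF Tq] by (simp_all add: T_bundle_def)
  have Tu: "Tar X u \<in> hom X (Tob X (Src X (proj b))) (Src X (proj ?T))"
    and Tv: "Tar X v \<in> hom X (Tob X (Src X (proj b))) (Src X (proj ?T))"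
    using Tar_hom[OF U(5)] Tar_hom[OF V(5)] by (simp_all add: pT)
  have Tuv: "Tar X u \<cdot> proj ?T = Tar X v \<cdot> proj ?T"
    using Tar_Cmp[OF U(5) dc(3)] Tar_Cmp[OF V(5) dc(3)] uv by (simp add: pT)
  have "fsum X c u v \<cdot> lift c = fsum X ?T (u \<cdot> lift c) (v \<cdot> lift c)"
    using additive_morphism_fsum[OF dc(2) T_bundle_has_fsum[OF U(2)] add U(5) V(5) uv] .
  also have "\<dots> = lift b \<cdot> fsum X ?T (Tar X u) (Tar X v)"
    using fsum_precomp[OF T_bundle_has_fsum[OF U(2)] Tu Tv Tuv db(6)] U(7) V(7) by simp
  also have "\<dots> = lift b \<cdot> Tar X (fsum X c u v)"
    using Tar_fsum[OF U(2) U(5) V(5) uv] by simp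
  finally show ?thesis
    using U V fsum_hom[OF dc(2) U(5) V(5) uv] fsum_proj[OF dc(2) U(5) V(5) uv]
    by (intro linear_overI) auto
qed

lemma fsum_comp:
  assumes u: "linear_over X E b c u" and v: "linear_over X E b c v" and g: "linear_over X E c d g"
  shows "fsum X c u v \<cdot> g = fsum X d (u \<cdot> g) (v \<cdot> g)"
proof -
  have lin: "linear_morphism X c d (Idn X E) g" using g by (simp add: linear_over_iff)
  have "u \<cdot> proj c = v \<cdot> proj c" using linear_overD(6)[OF u] linear_overD(6)[OF v] by simp
  from linear_fsum[OF linear_overD(1,2)[OF g] lin linear_overD(5)[OF u] linear_overD(5)[OF v] this]
  show ?thesis .
qed

lemma comp_fsum:
  assumes u: "linear_over X E b c u" and v: "linear_over X E b c v" and k: "linear_over X E a b k"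
  shows "k \<cdot> fsum X c u v = fsum X c (k \<cdot> u) (k \<cdot> v)"
proof -
  have uv: "u \<cdot> proj c = v \<cdot> proj c" using linear_overD(6)[OF u] linear_overD(6)[OF v] by simp
  show ?thesis
    using fsum_precomp[OF differential_bundleD(2)[OF linear_overD(2)[OF u]]
        linear_overD(5)[OF u] linear_overD(5)[OF v] uv linear_overD(5)[OF k]] .
qed

lemma fsum_null:
  assumes u: "linear_over X E b c u"
  shows fsum_null_right: "fsum X c u (null_map X b c) = u"
    and fsum_null_left: "fsum X c (null_map X b c) u = u"
proof -
  note c = differential_bundleD(1)[OF linear_overD(2)[OF u]]
  show "fsum X c u (null_map X b c) = u"
    using fsum_zero_right[OF c linear_overD(5)[OF u]]
    unfolding null_map_def linear_overD(6)[OF u] .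
  show "fsum X c (null_map X b c) u = u"
    using fsum_zero_left[OF c linear_overD(5)[OF u]]
    unfolding null_map_def linear_overD(6)[OF u] .
qed

text \<open>The trivial bundle is initial among the differential bundles over \<open>E\<close>, so a pushout under it is a
  coproduct.\<close>

lemma from_trivial_iff:
  assumes Z: "differential_bundle X (trivial_bundle X E)"
  shows "linear_over X E (trivial_bundle X E) c g \<longleftrightarrow>
    differential_bundle X c \<and> Tgt X (proj c) = E \<and> g = zero c"
proof
  assume g: "linear_over X E (trivial_bundle X E) c g"
  note G = linear_overD[OF g]
  have E: "E \<in> Ob X" using differential_bundleD(11)[OF Z] unfolding G(3) .
  have src: "Src X (proj (trivial_bundle X E)) = E" "zero (trivial_bundle X E) = Idn X E"
    using hom_Src[OF Idn_hom[OF E]] by (simp_all add: trivial_bundle_def)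
  have "g \<in> hom X E (Src X (proj c))" using G(5) unfolding src .
  then have "g = zero c" using linear_over_zero[OF g] Idn_left unfolding src by metis
  then show "differential_bundle X c \<and> Tgt X (proj c) = E \<and> g = zero c"
    using G(2,4) by blast
next
  assume c: "differential_bundle X c \<and> Tgt X (proj c) = E \<and> g = zero c"
  then have z: "zero c \<in> hom X E (Src X (proj c))" using differential_bundleD(4) by blast
  have "Tgt X (proj (trivial_bundle X E)) = E"
    using Idn_hom hom_Ob(1)[OF z] hom_Tgt by (fastforce simp: trivial_bundle_def)
  then have "linear_over X E (trivial_bundle X E) c (null_map X (trivial_bundle X E) c)"
    using c by (intro linear_over_null[OF Z]) blast+
  moreover have "null_map X (trivial_bundle X E) c = g"
    using Idn_left[OF z] c by (simp add: null_map_def trivial_bundle_def)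
  ultimately show "linear_over X E (trivial_bundle X E) c g" by simp
qed

lemma coproduct_iff_pushout:
  assumes Z: "differential_bundle X (trivial_bundle X E)"
    and i: "linear_over X E b d i" and j: "linear_over X E c d j"
  shows "is_pushout (DB X E) (trivial_bundle X E, zero b, b) (trivial_bundle X E, zero c, c)
           (b, i, d) (c, j, d) \<longleftrightarrow>
         (\<forall>y r s. linear_over X E b y r \<longrightarrow> linear_over X E c y s \<longrightarrow>
            (\<exists>!h. linear_over X E d y h \<and> i \<cdot> h = r \<and> j \<cdot> h = s))"
proof -
  note b = linear_overD(1,3)[OF i] and c = linear_overD(1,3)[OF j]
  have z: "zero b \<cdot> i = zero c \<cdot> j"
    using linear_over_zero[OF i] linear_over_zero[OF j] by simp
  have sq: "zero b \<cdot> r = zero c \<cdot> s"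
    if "linear_over X E b y r" "linear_over X E c y s" for y r s
    using linear_over_zero[OF that(1)] linear_over_zero[OF that(2)] by simp
  show ?thesis
    unfolding is_pushout_DB_iff from_trivial_iff[OF Z] using b c i j z sq by blast
qed

end

section \<open>Connections on a submersion\<close>

locale submersion_map = tangent_category X
  for X :: "('o, 'a, 'm) tangent_precat_scheme" (structure) +
  fixes q :: 'a
  assumes submersion: "submersion X q"
begin

abbreviation "E \<equiv> Src X q"
abbreviation "V \<equiv> vertical_bundle X q"
abbreviation "F \<equiv> finsler_bundle X q"
abbreviation "P \<equiv> tangent_bundle X E"
abbreviation "\<iota> \<equiv> iota X q"
abbreviation "\<pi> \<equiv> descent X q"
abbreviation "L \<equiv> linear_over X E"
abbreviation "\<O> \<equiv> null_map X"

lemma display: "tangent_display_map X q"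
  using submersion by (simp add: submersion_def)

lemma proj_simps: "proj V = projV X q" "proj F = projF X q"
  by (simp_all add: vertical_bundle_def finsler_bundle_def Let_def)

lemma pushout:
  "is_pushout (DB X E) (V, \<iota>, P) (V, proj V, trivial_bundle X E)
     (P, \<pi>, F) (trivial_bundle X E, zero F, F)"
  using submersion by (simp add: submersion_def Let_def proj_simps)

lemma iota_linear: "L V P \<iota>"
  and descent_linear: "L P F \<pi>"
  and iota_descent: "\<iota> \<cdot> \<pi> = \<O> V F"
  using pushout by (auto simp: is_pushout_DB_iff null_map_def)

lemma trivial_differential: "differential_bundle X (trivial_bundle X E)"
  using pushout linear_overD(2) by (auto simp: is_pushout_DB_iff)

lemmas V_DB = linear_overD(1,3)[OF iota_linear]
lemmas P_DB = linear_overD(2,4)[OF iota_linear]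
lemmas F_DB = linear_overD(2,4)[OF descent_linear]

lemma total_spaces: "Src X (proj V) = Vob X q" "Src X (proj F) = Fob X q"
    "Src X (tp X E) = Tob X E"
proof -
  show "Src X (proj V) = Vob X q"
    using linear_overD(5)[OF iota_linear] by (simp add: Vob_def hom_Src)
  show "Src X (proj F) = Fob X q" by (simp add: Fob_def proj_simps)
  show "Src X (tp X E) = Tob X E"
    using tp_hom[of E] V_DB differential_bundleD(11) hom_Src by metis
qed

text \<open>In the defining pushout the leg out of the trivial bundle carries no information, by
  initiality.\<close>

lemma descent_cokernel:
  assumes b: "L P y b" and ib: "\<iota> \<cdot> b = \<O> V y"
  shows "\<exists>!h. L F y h \<and> \<pi> \<cdot> h = b"
proof -
  have "L (trivial_bundle X E) y (zero y)"
    using linear_overD(2,4)[OF b] by (simp add: from_trivial_iff[OF trivial_differential])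
  then have "\<exists>!h. L F y h \<and> \<pi> \<cdot> h = b \<and> zero F \<cdot> h = zero y"
    using pushout b ib by (auto simp: is_pushout_DB_iff null_map_def)
  then show ?thesis using linear_over_zero by blast
qed

lemma descent_epi:
  assumes h: "L F y h" and h': "L F y h'" and e: "\<pi> \<cdot> h = \<pi> \<cdot> h'"
  shows "h = h'"
proof -
  have "\<iota> \<cdot> (\<pi> \<cdot> h') = \<O> V y"
    using linear_over_assoc[OF iota_linear descent_linear h'] iota_descent null_map_comp[OF V_DB h']
    by simp
  from descent_cokernel[OF linear_over_comp[OF descent_linear h'] this]
  show ?thesis using h h' e by blast
qed

lemma horizontal_connection_iff:
  "horizontal_connection X q H \<longleftrightarrow> L F P H \<and> H \<cdot> \<pi> = Idn X (Fob X q)"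
  using display F_DB P_DB total_spaces
  by (auto simp: horizontal_connection_def linear_over_iff linear_morphism_def Let_def)

lemma vertical_connection_iff:
  "vertical_connection X q R \<longleftrightarrow> L P V R \<and> \<iota> \<cdot> R = Idn X (Vob X q)"
  using display V_DB P_DB total_spaces
  by (auto simp: vertical_connection_def linear_over_iff linear_morphism_def Let_def)

lemma full_iff:
  "full_horizontal_connection X q H \<longleftrightarrow> horizontal_connection X q H \<and>
     (\<forall>y r s. L V y r \<longrightarrow> L F y s \<longrightarrow> (\<exists>!h. L P y h \<and> \<iota> \<cdot> h = r \<and> H \<cdot> h = s))"
  using coproduct_iff_pushout[OF trivial_differential iota_linear, of F H]
  unfolding full_horizontal_connection_def horizontal_connection_iff Let_def by blast

lemma ehresmann_iff:
  "ehresmann_connection X q R H \<longleftrightarrow> vertical_connection X q R \<and> horizontal_connection X q H \<and>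
     H \<cdot> R = \<O> F V \<and> fsum X P (R \<cdot> \<iota>) (\<pi> \<cdot> H) = Idn X (Tob X E)"
  by (simp add: ehresmann_connection_def null_map_def fsum_def proj_simps Let_def)

lemma abstract_iff:
  "abstract_horizontal_connection X q \<psi> \<longleftrightarrow> L P P \<psi> \<and> \<psi> \<cdot> \<psi> = \<psi> \<and> \<iota> \<cdot> \<psi> = \<O> V P \<and>
     (\<forall>y r s. L V y r \<longrightarrow> L P y s \<longrightarrow> \<iota> \<cdot> s = \<O> V y \<longrightarrow>
        (\<exists>!h. L P y h \<and> \<iota> \<cdot> h = r \<and> \<psi> \<cdot> h = s))"
proof -
  have n: "\<O> V V \<cdot> r = \<O> V y" if "L V y r" for y r
    using null_map_comp[OF V_DB that] .
  have pz: "projV X q \<cdot> zero V = \<O> V V" by (simp add: null_map_def proj_simps)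
  have L0: "L V V (\<O> V V)" using linear_over_null[OF V_DB V_DB] .
  have H: "\<psi> \<in> hom X (Tob X E) (Tob X E) \<and> linear_morphism X P P (Idn X E) \<psi> \<longleftrightarrow> L P P \<psi>"
    using P_DB total_spaces by (auto simp: linear_over_iff linear_morphism_def)
  have all: "(\<forall>y r s. L V y r \<longrightarrow> L P y s \<longrightarrow> \<O> V V \<cdot> r = \<iota> \<cdot> s \<longrightarrow>
        (\<exists>!h. L P y h \<and> \<iota> \<cdot> h = r \<and> \<psi> \<cdot> h = s)) \<longleftrightarrow>
      (\<forall>y r s. L V y r \<longrightarrow> L P y s \<longrightarrow> \<iota> \<cdot> s = \<O> V y \<longrightarrow>
        (\<exists>!h. L P y h \<and> \<iota> \<cdot> h = r \<and> \<psi> \<cdot> h = s))"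
    by (simp add: n eq_commute[of "\<O> V _"] cong: imp_cong)
  have sq: "\<O> V V \<cdot> \<iota> = \<iota> \<cdot> \<psi> \<longleftrightarrow> \<iota> \<cdot> \<psi> = \<O> V P"
    unfolding n[OF iota_linear] by (rule eq_commute)
  show ?thesis
    unfolding abstract_horizontal_connection_def Let_def is_pushout_DB_iff pz all sq
    using display H L0 iota_linear by blast
qed

lemma split_iff:
  "split_abstract_horizontal_connection X q \<psi> \<longleftrightarrow> abstract_horizontal_connection X q \<psi> \<and>
     (\<exists>r \<sigma> \<rho>. L r P \<sigma> \<and> L P r \<rho> \<and> \<sigma> \<cdot> \<rho> = Idn X (Src X (proj r)) \<and> \<rho> \<cdot> \<sigma> = \<psi>)"
proof -
  have ob: "r \<in> Ob (DB X E)" if "L r P \<sigma>" for r \<sigma>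
    using linear_overD(1,3)[OF that] by (simp add: DB_def Let_def)
  have bex: "(\<exists>t \<in> hom (DB X E) b c. Q t) \<longleftrightarrow> (\<exists>g. L b c g \<and> Q (b, g, c))" for b c Q
    by (auto simp: DB_hom_iff)
  show ?thesis
    unfolding split_abstract_horizontal_connection_def Let_def bex DB_simps prod.inject
    using ob by blast
qed

text \<open>A splitting of \<open>\<psi>\<close> comes for free: \<open>\<psi>\<close> kills \<open>\<iota>\<close>, so the cokernel property factors it through
  \<open>\<pi>\<close>, and the other factor is the connection.\<close>

lemma abstract_imp_full:
  assumes "abstract_horizontal_connection X q \<psi>"
  shows "\<exists>H. full_horizontal_connection X q H \<and> \<pi> \<cdot> H = \<psi>"
proof -
  from assms have psi: "L P P \<psi>" "\<psi> \<cdot> \<psi> = \<psi>" "\<iota> \<cdot> \<psi> = \<O> V P"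
    and po: "\<And>y r s. L V y r \<Longrightarrow> L P y s \<Longrightarrow> \<iota> \<cdot> s = \<O> V y \<Longrightarrow>
        (\<exists>!h. L P y h \<and> \<iota> \<cdot> h = r \<and> \<psi> \<cdot> h = s)"
    unfolding abstract_iff by blast+
  obtain H where H: "L F P H" "\<pi> \<cdot> H = \<psi>"
    using descent_cokernel[OF psi(1,3)] by blast
  obtain h where h: "L P F h" "\<psi> \<cdot> h = \<pi>"
    using po[OF linear_over_null[OF V_DB F_DB] descent_linear iota_descent] by blast
  \<comment> \<open>\<open>\<pi>\<close> factors through the idempotent, hence absorbs it\<close>
  have "\<psi> \<cdot> \<pi> = \<pi>"
    using linear_over_assoc[OF psi(1) psi(1) h(1)] h(2) psi(2) by simp
  then have "\<pi> \<cdot> (H \<cdot> \<pi>) = \<pi> \<cdot> Idn X (Fob X q)"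
    using linear_over_assoc[OF descent_linear H(1) descent_linear] H(2)
      Idn_right[OF linear_overD(5)[OF descent_linear]] total_spaces by simp
  then have "H \<cdot> \<pi> = Idn X (Fob X q)"
    using descent_epi linear_over_comp[OF H(1) descent_linear] linear_over_Idn[OF F_DB]
    by (simp add: total_spaces)
  then have hc: "horizontal_connection X q H" using H(1) by (simp add: horizontal_connection_iff)
  \<comment> \<open>translates the test data \<open>s\<close> for the coproduct into the data \<open>\<pi> s\<close> for the pushout of \<open>\<psi>\<close>\<close>
  have eq: "\<psi> \<cdot> h = \<pi> \<cdot> s \<longleftrightarrow> H \<cdot> h = s" if "L P y h" "L F y s" for y h s
    using linear_over_assoc[OF descent_linear H(1) that(1)] H(2) 
      descent_epi[OF linear_over_comp[OF H(1) that(1)] that(2)] by auto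
  have "\<exists>!h. L P y h \<and> \<iota> \<cdot> h = r \<and> H \<cdot> h = s" if r: "L V y r" and s: "L F y s" for y r s
  proof -
    have "\<iota> \<cdot> (\<pi> \<cdot> s) = \<O> V y"
      using linear_over_assoc[OF iota_linear descent_linear s] iota_descent null_map_comp[OF V_DB s]
      by simp
    from po[OF r linear_over_comp[OF descent_linear s] this]
    show ?thesis using eq s by (metis (no_types, lifting))
  qed
  then have "full_horizontal_connection X q H" using hc unfolding full_iff by blast
  then show ?thesis using H(2) by blast
qed

lemma full_imp_split:
  assumes "full_horizontal_connection X q H"
  shows "split_abstract_horizontal_connection X q (\<pi> \<cdot> H)"
proof -
  from assms have H: "L F P H" "H \<cdot> \<pi> = Idn X (Fob X q)"
    and co: "\<And>y r s. L V y r \<Longrightarrow> L F y s \<Longrightarrow> (\<exists>!h. L P y h \<and> \<iota> \<cdot> h = r \<and> H \<cdot> h = s)"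
    unfolding full_iff horizontal_connection_iff by blast+
  have psi: "L P P (\<pi> \<cdot> H)" using linear_over_comp[OF descent_linear H(1)] .
  have idem: "(\<pi> \<cdot> H) \<cdot> (\<pi> \<cdot> H) = \<pi> \<cdot> H"
    using linear_over_assoc[OF descent_linear H(1) psi]
      linear_over_assoc[OF H(1) descent_linear H(1)] H(2)
      Idn_left[OF linear_overD(5)[OF H(1)]] total_spaces by simp
  have null: "\<iota> \<cdot> (\<pi> \<cdot> H) = \<O> V P"
    using linear_over_assoc[OF iota_linear descent_linear H(1)] iota_descent
      null_map_comp[OF V_DB H(1)] by simp
  have "\<exists>!h. L P y h \<and> \<iota> \<cdot> h = r \<and> (\<pi> \<cdot> H) \<cdot> h = s"
    if r: "L V y r" and s: "L P y s" and null_s: "\<iota> \<cdot> s = \<O> V y" for y r s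
  proof -
    obtain s' where s': "L F y s'" "\<pi> \<cdot> s' = s" using descent_cokernel[OF s null_s] by blast
    have "(\<pi> \<cdot> H) \<cdot> h = s \<longleftrightarrow> H \<cdot> h = s'" if "L P y h" for h
      using linear_over_assoc[OF descent_linear H(1) that] s'(2)
        descent_epi[OF linear_over_comp[OF H(1) that] s'(1)] by auto
    then show ?thesis using co[OF r s'(1)] by (metis (no_types, lifting))
  qed
  then have "abstract_horizontal_connection X q (\<pi> \<cdot> H)"
    using psi idem null unfolding abstract_iff by blast
  then show ?thesis
    unfolding split_iff using H(1) descent_linear H(2)[folded total_spaces(2)] by blast
qed

lemma full_imp_ehresmann:
  assumes full: "full_horizontal_connection X q H"
  shows "\<exists>R. ehresmann_connection X q R H"
proof -
  from full have H: "L F P H" "H \<cdot> \<pi> = Idn X (Fob X q)"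
    and co: "\<And>y r s. L V y r \<Longrightarrow> L F y s \<Longrightarrow> (\<exists>!h. L P y h \<and> \<iota> \<cdot> h = r \<and> H \<cdot> h = s)"
    and hc: "horizontal_connection X q H"
    unfolding full_iff horizontal_connection_iff by blast+
  obtain R where R: "L P V R" "\<iota> \<cdot> R = Idn X (Vob X q)" "H \<cdot> R = \<O> F V"
    using co[OF linear_over_Idn[OF V_DB] linear_over_null[OF F_DB V_DB]] total_spaces by auto
  have Ri: "L P P (R \<cdot> \<iota>)" and pH: "L P P (\<pi> \<cdot> H)"
    using linear_over_comp R(1) H(1) iota_linear descent_linear by blast+
  have "\<iota> \<cdot> fsum X P (R \<cdot> \<iota>) (\<pi> \<cdot> H) = fsum X P \<iota> (\<O> V P)"
    using comp_fsum[OF Ri pH iota_linear] linear_over_assoc[OF iota_linear R(1) iota_linear] R(2)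
      linear_over_assoc[OF iota_linear descent_linear H(1)] iota_descent null_map_comp[OF V_DB H(1)]
      Idn_left[OF linear_overD(5)[OF iota_linear]] total_spaces by simp
  then have 1: "\<iota> \<cdot> fsum X P (R \<cdot> \<iota>) (\<pi> \<cdot> H) = \<iota>"
    using fsum_null_right[OF iota_linear] by simp
  have "H \<cdot> fsum X P (R \<cdot> \<iota>) (\<pi> \<cdot> H) = fsum X P (\<O> F P) H"
    using comp_fsum[OF Ri pH H(1)] linear_over_assoc[OF H(1) R(1) iota_linear] R(3)
      linear_over_assoc[OF H(1) descent_linear H(1)] H(2) null_map_comp[OF F_DB iota_linear]
      Idn_left[OF linear_overD(5)[OF H(1)]] total_spaces by simp
  then have 2: "H \<cdot> fsum X P (R \<cdot> \<iota>) (\<pi> \<cdot> H) = H"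
    using fsum_null_left[OF H(1)] by simp
  have 3: "L P P (Idn X (Tob X E))" using linear_over_Idn[OF P_DB] total_spaces by simp
  have 4: "\<iota> \<cdot> Idn X (Tob X E) = \<iota>" "H \<cdot> Idn X (Tob X E) = H"
    using Idn_right[OF linear_overD(5)[OF iota_linear]] Idn_right[OF linear_overD(5)[OF H(1)]]
      total_spaces by simp_all
  have "fsum X P (R \<cdot> \<iota>) (\<pi> \<cdot> H) = Idn X (Tob X E)"
    using co[OF iota_linear H(1)] linear_over_fsum[OF Ri pH] 1 2 3 4 by blast
  then show ?thesis using R hc by (auto simp: ehresmann_iff vertical_connection_iff)
qed

lemma ehresmann_imp_full:
  assumes "ehresmann_connection X q R H"
  shows "full_horizontal_connection X q H"
proof -
  from assms have R: "L P V R" "\<iota> \<cdot> R = Idn X (Vob X q)"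
    and H: "L F P H" "H \<cdot> \<pi> = Idn X (Fob X q)"
    and hc: "horizontal_connection X q H"
    and HR: "H \<cdot> R = \<O> F V" and one: "fsum X P (R \<cdot> \<iota>) (\<pi> \<cdot> H) = Idn X (Tob X E)"
    by (auto simp: ehresmann_iff vertical_connection_iff horizontal_connection_iff)
  have Ri: "L P P (R \<cdot> \<iota>)" and pH: "L P P (\<pi> \<cdot> H)"
    using linear_over_comp R(1) H(1) iota_linear descent_linear by blast+
  have "\<exists>!h. L P y h \<and> \<iota> \<cdot> h = r \<and> H \<cdot> h = s" if r: "L V y r" and s: "L F y s" for y r s
  proof
    have Rr: "L P y (R \<cdot> r)" and ps: "L P y (\<pi> \<cdot> s)"
      using linear_over_comp R(1) descent_linear r s by blast+
    let ?h = "fsum X y (R \<cdot> r) (\<pi> \<cdot> s)"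
    have "\<iota> \<cdot> ?h = fsum X y r (\<O> V y)"
      using comp_fsum[OF Rr ps iota_linear] linear_over_assoc[OF iota_linear R(1) r] R(2)
        linear_over_assoc[OF iota_linear descent_linear s] iota_descent null_map_comp[OF V_DB s]
        Idn_left[OF linear_overD(5)[OF r]] total_spaces by simp
    moreover have "H \<cdot> ?h = fsum X y (\<O> F y) s"
      using comp_fsum[OF Rr ps H(1)] linear_over_assoc[OF H(1) R(1) r] HR
        linear_over_assoc[OF H(1) descent_linear s] H(2) null_map_comp[OF F_DB r]
        Idn_left[OF linear_overD(5)[OF s]] total_spaces by simp
    ultimately show "L P y ?h \<and> \<iota> \<cdot> ?h = r \<and> H \<cdot> ?h = s"
      using linear_over_fsum[OF Rr ps] fsum_null_right[OF r] fsum_null_left[OF s] by simp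
    fix h assume h: "L P y h \<and> \<iota> \<cdot> h = r \<and> H \<cdot> h = s"
    then have hL: "L P y h" by simp
    have "h = fsum X P (R \<cdot> \<iota>) (\<pi> \<cdot> H) \<cdot> h"
      using one Idn_left[OF linear_overD(5)[OF hL]] total_spaces by simp
    also have "\<dots> = ?h"
      using fsum_comp[OF Ri pH hL] linear_over_assoc[OF R(1) iota_linear hL]
        linear_over_assoc[OF descent_linear H(1) hL] h by simp
    finally show "h = ?h" .
  qed
  then show ?thesis using hc unfolding full_iff by blast
qed

end

text \<open>That a full \<open>H\<close> is the horizontal component of an Ehresmann connection, and conversely, holds
  for each \<open>H\<close> separately; the connection form enters only in the comparison with \<open>\<psi>\<close>.\<close>

theorem theorem3p46:
  fixes X :: "('o, 'a, 'm) tangent_precat_scheme" and q \<psi> :: 'a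
  assumes "tangent_category X"
    and "submersion X q"
    and "\<psi> \<in> hom X (Tob X (Src X q)) (Tob X (Src X q))"
  shows "(split_abstract_horizontal_connection X q \<psi> \<longleftrightarrow>
            (\<exists>H. full_horizontal_connection X q H \<and> connection_form X q H = \<psi>)) \<and>
         ((\<exists>H. full_horizontal_connection X q H \<and> connection_form X q H = \<psi>) \<longleftrightarrow>
            (\<exists>H. horizontal_connection X q H \<and> (\<exists>R. ehresmann_connection X q R H) \<and>
                 connection_form X q H = \<psi>))"
proof -
  interpret tangent_category X by fact
  interpret submersion_map X q by unfold_locales fact
  have "split_abstract_horizontal_connection X q \<psi> \<longleftrightarrow>
      (\<exists>H. full_horizontal_connection X q H \<and> connection_form X q H = \<psi>)"
    using abstract_imp_full full_imp_split unfolding split_iff connection_form_def by blast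
  moreover have "full_horizontal_connection X q H \<longleftrightarrow>
      horizontal_connection X q H \<and> (\<exists>R. ehresmann_connection X q R H)" for H
    using full_imp_ehresmann ehresmann_imp_full full_iff by blast
  ultimately show ?thesis by auto
qed

end
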